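(* Let $M$ and $N$ be smooth closed manifolds of dimensions at least $1$ and fix a cost $c\in C^1(M\times N)$. Let $\mu$ on $M$ and $\nu$ on $N$ be Borel probability measures, both absolutely continuous with respect to Lebesgue measure, and let $\Pi_0$ denote the set of all minimizers of $\gamma\mapsto\int_{M\times N}c\,d\gamma$ on $\Pi(\mu,\nu)$. Let $E_0\subset M\times N$ be a $\sigma$-compact set which is negligible for all $\gamma\in\Pi_0$, put $\tilde{\mathcal S}:=(M\times N)\setminus E_0$, and let $E_\infty$ denote the set of points of $M\times N$ which occur in $k$-chains in $\tilde{\mathcal S}$ for arbitrarily large $k$. If either $\mu(\pi^M(E_\infty))=0$ or $\nu(\pi^N(E_\infty))=0$, then $\gamma(E_\infty)=0$ for every $\gamma\in\Pi_0$, and therefore $\Pi_0$ is a singleton.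
   Context: A closed manifold is a compact manifold without boundary. $\Pi(\mu,\nu)$ is the set of non-negative Borel measures on $M\times N$ with marginals $\mu$ and $\nu$. $\pi^M,\pi^N$ are the projections of $M\times N$ onto $M$ and $N$. Absolute continuity is understood in local charts. A set $A\subset M\times N$ is $c$-cyclically monotone if for all integers $I\ge1$ and all $(x_i,y_i)\in A$, $i=1,\dots,I$, with $x_{I+1}=x_1$, one has $\sum_{i=1}^I[c(x_{i+1},y_i)-c(x_i,y_i)]\ge0$. For $S\subset M\times N$, a chain in $S$ of length $L\ge1$ ($L$-chain) is an ordered family $((x_1,y_1),\dots,(x_L,y_L))\in S^L$ such that the set $\{(x_1,y_1),\dots,(x_L,y_L)\}$ is $c$-cyclically monotone and, for every $l=1,\dots,L-1$, either $$x_l=x_{l+1},\quad y_l\ne y_{l+1}=y_{\min\{L,l+2\}},\quad \frac{\partial c}{\partial x}(x_l,y_l)=\frac{\partial c}{\partial x}(x_l,y_{l+1}),$$ or $$y_l=y_{l+1},\quad x_l\ne x_{l+1}=x_{\min\{L,l+2\}},\quad \frac{\partial c}{\partial y}(x_l,y_l)=\frac{\partial c}{\partial y}(x_{l+1},y_l).$$ *)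

theory Defs
  imports "HOL-Probability.Probability"
begin

text \<open>
  A manifold is a type, which carries the topology, together with a smooth atlas whose charts take
  values in a Euclidean space; the dimension is that of this space and is therefore at least 1.
\<close>

primrec Ck_on :: "nat \<Rightarrow> 'a::real_normed_vector set \<Rightarrow> ('a \<Rightarrow> 'b::real_normed_vector) \<Rightarrow> bool" where
  "Ck_on 0 S f \<longleftrightarrow> continuous_on S f"
| "Ck_on (Suc k) S f \<longleftrightarrow>
     (\<forall>x\<in>S. f differentiable (at x)) \<and> (\<forall>v. Ck_on k S (\<lambda>x. frechet_derivative f (at x) v))"

definition smooth_on :: "'a::real_normed_vector set \<Rightarrow> ('a \<Rightarrow> 'b::real_normed_vector) \<Rightarrow> bool" where
  "smooth_on S f \<longleftrightarrow> (\<forall>k. Ck_on k S f)"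

type_synonym ('a, 'e) chart = "'a set \<times> ('a \<Rightarrow> 'e)"

definition is_chart :: "('a::topological_space, 'e::euclidean_space) chart \<Rightarrow> bool" where
  "is_chart = (\<lambda>(U, \<phi>). open U \<and> open (\<phi> ` U) \<and> homeomorphism U (\<phi> ` U) \<phi> (inv_into U \<phi>))"

definition smooth_atlas :: "('a::topological_space, 'e::euclidean_space) chart set \<Rightarrow> bool" where
  "smooth_atlas \<A> \<longleftrightarrow>
     (\<forall>C\<in>\<A>. is_chart C) \<and> (\<Union>C\<in>\<A>. fst C) = UNIV \<and>
     (\<forall>(U, \<phi>)\<in>\<A>. \<forall>(V, \<psi>)\<in>\<A>. smooth_on (\<phi> ` (U \<inter> V)) (\<psi> \<circ> inv_into U \<phi>))"

definition closed_manifold ::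
  "('a::{second_countable_topology, t2_space}, 'e::euclidean_space) chart set \<Rightarrow> bool" where
  "closed_manifold \<A> \<longleftrightarrow> smooth_atlas \<A> \<and> compact (UNIV :: 'a set)"

definition prod_atlas ::
  "('a, 'e) chart set \<Rightarrow> ('b, 'f) chart set \<Rightarrow> ('a \<times> 'b, 'e \<times> 'f) chart set" where
  "prod_atlas \<A> \<B> = (\<lambda>((U, \<phi>), (V, \<psi>)). (U \<times> V, map_prod \<phi> \<psi>)) ` (\<A> \<times> \<B>)"

definition Ck_function :: "nat \<Rightarrow> ('a, 'e::euclidean_space) chart set \<Rightarrow> ('a \<Rightarrow> real) \<Rightarrow> bool" where
  "Ck_function k \<A> f \<longleftrightarrow> (\<forall>(U, \<phi>)\<in>\<A>. Ck_on k (\<phi> ` U) (f \<circ> inv_into U \<phi>))"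

text \<open>
  A cotangent vector at \<open>x\<close> is encoded as the family of its coordinate expressions in all charts of
  the atlas around \<open>x\<close>.  Hence two differentials at the same point \<open>x\<close> are equal as such families
  iff they are equal in the cotangent space at \<open>x\<close>.
\<close>

definition differential ::
  "('a, 'e::euclidean_space) chart set \<Rightarrow> ('a \<Rightarrow> real) \<Rightarrow> 'a \<Rightarrow> ('a, 'e) chart \<Rightarrow> 'e \<Rightarrow> real" where
  "differential \<A> f x = (\<lambda>(U, \<phi>). if (U, \<phi>) \<in> \<A> \<and> x \<in> U
     then frechet_derivative (f \<circ> inv_into U \<phi>) (at (\<phi> x)) else (\<lambda>_. 0))"

definition partial_x ::
  "('a, 'e::euclidean_space) chart set \<Rightarrow> ('a \<times> 'b \<Rightarrow> real) \<Rightarrow> 'a \<Rightarrow> 'b \<Rightarrow> ('a, 'e) chart \<Rightarrow> 'e \<Rightarrow> real" where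
  "partial_x \<A> c x y = differential \<A> (\<lambda>x'. c (x', y)) x"

definition partial_y ::
  "('b, 'f::euclidean_space) chart set \<Rightarrow> ('a \<times> 'b \<Rightarrow> real) \<Rightarrow> 'a \<Rightarrow> 'b \<Rightarrow> ('b, 'f) chart \<Rightarrow> 'f \<Rightarrow> real" where
  "partial_y \<B> c x y = differential \<B> (\<lambda>y'. c (x, y')) y"

definition abs_continuous_in_charts ::
  "('a::topological_space, 'e::euclidean_space) chart set \<Rightarrow> 'a measure \<Rightarrow> bool" where
  "abs_continuous_in_charts \<A> \<mu> \<longleftrightarrow>
     (\<forall>(U, \<phi>)\<in>\<A>. absolutely_continuous lborel (distr (restrict_space \<mu> U) borel \<phi>))"

definition couplings ::
  "'a::topological_space measure \<Rightarrow> 'b::topological_space measure \<Rightarrow> ('a \<times> 'b) measure set" where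
  "couplings \<mu> \<nu> =
     {\<gamma>. sets \<gamma> = sets borel \<and> distr \<gamma> borel fst = \<mu> \<and> distr \<gamma> borel snd = \<nu>}"

definition optimal_couplings ::
  "('a::topological_space \<times> 'b::topological_space \<Rightarrow> real) \<Rightarrow> 'a measure \<Rightarrow> 'b measure \<Rightarrow>
     ('a \<times> 'b) measure set" where
  "optimal_couplings c \<mu> \<nu> =
     {\<gamma>. is_arg_min (\<lambda>\<gamma>. \<integral>p. c p \<partial>\<gamma>) (\<lambda>\<gamma>. \<gamma> \<in> couplings \<mu> \<nu>) \<gamma>}"

definition sigma_compact :: "'a::topological_space set \<Rightarrow> bool" where
  "sigma_compact E \<longleftrightarrow> (\<exists>K :: nat \<Rightarrow> 'a set. (\<forall>n. compact (K n)) \<and> E = (\<Union>n. K n))"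

definition cyclically_monotone :: "('a \<times> 'b \<Rightarrow> real) \<Rightarrow> ('a \<times> 'b) set \<Rightarrow> bool" where
  "cyclically_monotone c A \<longleftrightarrow>
     (\<forall>I\<ge>1. \<forall>x y. (\<forall>i<I. (x i, y i) \<in> A) \<longrightarrow>
        (\<Sum>i<I. c (x (Suc i mod I), y i) - c (x i, y i)) \<ge> 0)"

text \<open>The entries of a chain of length \<open>L\<close> are indexed by \<open>0, \<dots>, L - 1\<close>.\<close>

definition is_chain ::
  "('a, 'e::euclidean_space) chart set \<Rightarrow> ('b, 'f::euclidean_space) chart set \<Rightarrow>
     ('a \<times> 'b \<Rightarrow> real) \<Rightarrow> ('a \<times> 'b) set \<Rightarrow> ('a \<times> 'b) list \<Rightarrow> bool" where
  "is_chain \<A> \<B> c S p \<longleftrightarrow>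
     (let L = length p; x = (\<lambda>l. fst (p ! l)); y = (\<lambda>l. snd (p ! l)) in
       L \<ge> 1 \<and> set p \<subseteq> S \<and> cyclically_monotone c (set p) \<and>
       (\<forall>l. l + 1 < L \<longrightarrow>
          (x l = x (l + 1) \<and> y l \<noteq> y (l + 1) \<and> y (l + 1) = y (min (L - 1) (l + 2)) \<and>
             partial_x \<A> c (x l) (y l) = partial_x \<A> c (x l) (y (l + 1))) \<or>
          (y l = y (l + 1) \<and> x l \<noteq> x (l + 1) \<and> x (l + 1) = x (min (L - 1) (l + 2)) \<and>
             partial_y \<B> c (x l) (y l) = partial_y \<B> c (x (l + 1)) (y l))))"

definition E_infinity ::
  "('a, 'e::euclidean_space) chart set \<Rightarrow> ('b, 'f::euclidean_space) chart set \<Rightarrow>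
     ('a \<times> 'b \<Rightarrow> real) \<Rightarrow> ('a \<times> 'b) set \<Rightarrow> ('a \<times> 'b) set" where
  "E_infinity \<A> \<B> c S =
     {z. \<forall>n. \<exists>k\<ge>n. \<exists>p. is_chain \<A> \<B> c S p \<and> length p = k \<and> z \<in> set p}"

text \<open>
  The set \<open>E_infinity \<A> \<B> c S\<close> and its projections need not be Borel, and \<^const>\<open>emeasure\<close> is 0 on
  every non-measurable set.  Negligibility is therefore meant with respect to the completion.
\<close>

definition negligible_for :: "'a measure \<Rightarrow> 'a set \<Rightarrow> bool" where
  "negligible_for \<mu> A \<longleftrightarrow> A \<in> null_sets (completion \<mu>)"

end

theory Submission
  imports Defs
begin

text \<open>
  Both marginals of a coupling are prescribed, so an optimal coupling cannot charge \<open>E_infinity\<close> once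
  one of the two projections of that set is negligible. What has to be shown is that this
  forces two optimal couplings \<open>\<gamma>\<close> and \<open>\<gamma>'\<close> to coincide.

  Every optimal coupling has a \<open>c\<close>-cyclically monotone support, and even the union \<open>S\<close> of the supports
  of \<open>\<gamma>\<close> and \<open>\<gamma>'\<close> is \<open>c\<close>-cyclically monotone (\<open>union_supports_cyclically_monotone\<close>): otherwise
  permuting the first coordinates of independent samples near a bad cycle would lower the cost. Regard \<open>S\<close> as
  the edge set of a bipartite graph on the disjoint union of the two manifolds. For almost every \<open>x\<close> all edges
  at \<open>x\<close> have the same partial differential of \<open>c\<close> in \<open>x\<close>, and likewise on the other side
  (\<open>partial_x_nonunique_negligible\<close>). This replaces the almost everywhere differentiability of Kantorovich
  potentials and rests on monotonicity along two-cycles. If edges \<open>(a, y)\<close> and \<open>(a, z)\<close>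
  have different slopes in a direction \<open>v\<close>, and the same happens at another point of the line \<open>a + \<real> v\<close> with the
  slopes separated by the same gap, then the mean value theorem contradicts two-cycle
  monotonicity as soon as the points are close. So the bad set is locally a union of countably many
  sets, each of which meets every line in some fixed coordinate direction at most once; such sets
  are null.

  Hence both couplings live on a \<open>\<sigma>\<close>-compact set \<open>T\<close> of edges disjoint from \<open>E\<^sub>0\<close>, on which every walk without
  backtracking is a chain. Now prune the graph: an edge is removed when one of its end points
  has degree one. On the edges that are alone at their left end point a measure is
  determined by its first marginal and by what it does off \<open>T\<close>, where both couplings vanish. So the
  couplings agree on these edges, and likewise on the edges that are alone at their right end point.
  Consequently the two couplings agree on everything that is removed, hence have equal marginals on the remaining graph, and pruning can be repeated
  (\<open>couplings_agree_off_prune_iter\<close>). An edge that survives \<open>n\<close> rounds starts a walk of length \<open>n + 1\<close>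
  without backtracking, so the edges that are never removed lie in \<open>E_infinity\<close> and are
  not charged. The choice of \<open>\<sigma>\<close>-compact sets keeps everything measurable, because projections of
  compact sets are compact.

  Existence of an optimal coupling is weak compactness of the set of couplings
  (\<open>prob_measures_sequentially_compact\<close>), which is reduced to Helly's theorem on the real line by coding a
  compact space as a continuous image of a compact set of reals.
\<close>

section \<open>Regularity of finite Borel measures on compact spaces\<close>

lemma closed_imp_compact_of_compact_UNIV:
  fixes C :: "'x::topological_space set"
  assumes "compact (UNIV :: 'x set)" "closed C"
  shows "compact C"
  using compact_Int_closed[OF assms] by simp

lemma Urysohn_compact_t2:
  fixes S T :: "'x::t2_space set"
  assumes "compact (UNIV :: 'x set)" "closed S" "closed T" "S \<inter> T = {}"
  obtains f :: "'x \<Rightarrow> real" where "continuous_on UNIV f" "\<And>x. 0 \<le> f x \<and> f x \<le> 1"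
    "\<And>x. x \<in> S \<Longrightarrow> f x = 0" "\<And>x. x \<in> T \<Longrightarrow> f x = 1"
proof -
  have "Hausdorff_space (euclidean :: 'x topology)"
    unfolding Hausdorff_space_def disjnt_def open_openin[symmetric] using hausdorff by blast
  moreover have "compact_space (euclidean :: 'x topology)"
    using assms(1) by (simp add: compact_space_def)
  ultimately have "normal_space (euclidean :: 'x topology)"
    using compact_Hausdorff_or_regular_imp_normal_space by blast
  moreover have "closedin euclidean S" "closedin euclidean T" "disjnt S T"
    using assms by (auto simp: disjnt_def)
  ultimately obtain f :: "'x \<Rightarrow> real" where f: "continuous_map euclidean (top_of_set {0..1}) f"
      "f ` S \<subseteq> {0}" "f ` T \<subseteq> {1}"
    using Urysohn_lemma[of "euclidean :: 'x topology" S T 0 1] by auto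
  show thesis
  proof
    show "continuous_on UNIV f"
      using f(1) by (auto simp: continuous_map_in_subtopology)
    show "0 \<le> f x \<and> f x \<le> 1" for x
      using f(1) by (auto simp: continuous_map_in_subtopology)
  qed (use f in auto)
qed

text \<open>
  By normality each point of an open set has a basic neighbourhood whose closure stays inside, and
  there are countably many basic sets. This substitutes for a metric on the space.
\<close>

lemma open_imp_countable_Union_closed:
  fixes U :: "'x::{second_countable_topology, t2_space} set"
  assumes cpt: "compact (UNIV :: 'x set)" and U: "open U"
  obtains K :: "nat \<Rightarrow> 'x set" where "\<And>n. closed (K n)" "U = (\<Union>n. K n)"
proof -
  obtain B :: "'x set set" where B: "countable B" "topological_basis B"
    using ex_countable_basis by blast
  define B' where "B' = insert {} {closure b |b. b \<in> B \<and> closure b \<subseteq> U}"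
  have "countable B'"
    unfolding B'_def using B(1) by (simp add: setcompr_eq_image)
  moreover have "B' \<noteq> {}" by (simp add: B'_def)
  ultimately have range: "range (from_nat_into B') = B'"
    by (rule range_from_nat_into[rotated])
  have "\<exists>C\<in>B'. x \<in> C" if "x \<in> U" for x
  proof -
    have sep: "closed {x}" "closed (- U)" "{x} \<inter> - U = {}" using that U by auto
    obtain f :: "'x \<Rightarrow> real" where f': "continuous_on UNIV f" "\<And>x. 0 \<le> f x \<and> f x \<le> 1" "\<And>y. y \<in> {x} \<Longrightarrow> f y = 0"
        "\<And>y. y \<in> - U \<Longrightarrow> f y = 1"
      by (rule Urysohn_compact_t2[OF cpt sep]) (rule that, assumption+)
    then have f: "continuous_on UNIV f" "f x = 0" "\<And>y. y \<in> - U \<Longrightarrow> f y = 1" by auto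
    have "open {y. f y < 1/2}"
      by (intro open_Collect_less f(1) continuous_on_const)
    then obtain b where b: "b \<in> B" "x \<in> b" "b \<subseteq> {y. f y < 1/2}"
      using B(2) f(2) by (auto elim!: topological_basisE[where x = x])
    have "closure b \<subseteq> {y. f y \<le> 1/2}"
      using b(3) f(1) by (intro closure_minimal closed_Collect_le) auto
    also have "\<dots> \<subseteq> U"
    proof
      fix y assume "y \<in> {y. f y \<le> 1/2}"
      then show "y \<in> U" using f(3)[of y] by force
    qed
    finally have "closure b \<in> B'" using b(1) by (auto simp: B'_def)
    then show ?thesis using b(2) closure_subset by blast
  qed
  moreover have "C \<subseteq> U" "closed C" if "C \<in> B'" for C
    using that by (auto simp: B'_def)
  ultimately have "U = \<Union> B'" by blast
  show thesis
  proof
    show "closed (from_nat_into B' n)" for n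
      using \<open>\<And>C. C \<in> B' \<Longrightarrow> closed C\<close> range by blast
    show "U = (\<Union>n. from_nat_into B' n)" using \<open>U = \<Union> B'\<close> range by simp
  qed
qed

text \<open>
  The sets that are squeezed between closed and open sets with arbitrarily small difference form
  a \<open>\<sigma>\<close>-algebra, and open sets belong to it because they are countable unions of closed sets.
\<close>

lemma finite_borel_measure_regular:
  fixes M :: "'x::{second_countable_topology, t2_space} measure"
  assumes cpt: "compact (UNIV :: 'x set)" and M: "finite_measure M" "sets M = sets borel"
    and A: "A \<in> sets borel" and e: "0 < (e::real)"
  obtains C U where "closed C" "open U" "C \<subseteq> A" "A \<subseteq> U" "measure M (U - C) < e"
proof -
  interpret finite_measure M by fact
  have [measurable_cong]: "sets M = sets borel" by fact
  have [simp]: "closed C \<Longrightarrow> C \<in> sets M" "open C \<Longrightarrow> C \<in> sets M" for C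
    unfolding M(2) by simp_all
  have "A \<in> sigma_sets UNIV {S. open S}"
    using A by (simp add: borel_def)
  then have "\<forall>e>0. \<exists>C U. closed C \<and> open U \<and> C \<subseteq> A \<and> A \<subseteq> U \<and> measure M (U - C) < e"
  proof induction
    case (Basic a)
    show ?case
    proof (intro allI impI)
      fix e :: real assume "0 < e"
      obtain K :: "nat \<Rightarrow> 'x set" where K: "\<And>n. closed (K n)" "a = (\<Union>n. K n)"
        using open_imp_countable_Union_closed[OF cpt] Basic by blast
      define D where "D n = a - (\<Union>i\<le>n. K i)" for n
      have "D n \<in> sets M" for n
        using K(1) Basic unfolding D_def by (intro sets.Diff sets.finite_UN) auto
      moreover have "decseq D"
        unfolding D_def decseq_def by (intro allI impI Diff_mono UN_mono) auto
      moreover have "(\<Inter>n. D n) = {}"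
        unfolding D_def K(2) by auto
      ultimately have "(\<lambda>n. measure M (D n)) \<longlonglongrightarrow> 0"
        using finite_Lim_measure_decseq[of D] by (simp add: image_subset_iff)
      then have "\<forall>\<^sub>F n in sequentially. measure M (D n) < e"
        using \<open>0 < e\<close> by (rule order_tendstoD)
      then obtain n where "measure M (D n) < e"
        using eventually_happens' sequentially_bot by blast
      then show "\<exists>C U. closed C \<and> open U \<and> C \<subseteq> a \<and> a \<subseteq> U \<and> measure M (U - C) < e"
        using K(1) Basic unfolding D_def
        by (intro exI[of _ "\<Union>i\<le>n. K i"] exI[of _ a]) (auto simp: K(2))
    qed
  next
    case Empty
    have "closed {} \<and> open {} \<and> {} \<subseteq> ({}::'x set) \<and> {} \<subseteq> ({}::'x set) \<and> measure M ({} - {}) < e"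
      if "0 < e" for e using that by simp
    then show ?case by blast
  next
    case (Compl a)
    show ?case
    proof (intro allI impI)
      fix e :: real assume "0 < e"
      then obtain C U where "closed C" "open U" "C \<subseteq> a" "a \<subseteq> U" "measure M (U - C) < e"
        using Compl.IH by meson
      moreover have "- C - (- U) = U - C" by auto
      ultimately show "\<exists>C U. closed C \<and> open U \<and> C \<subseteq> UNIV - a \<and> UNIV - a \<subseteq> U \<and> measure M (U - C) < e"
        by (intro exI[of _ "- U"] exI[of _ "- C"]) (auto simp: closed_Compl open_Compl)
    qed
  next
    case (Union a)
    show ?case
    proof (intro allI impI)
      fix e :: real assume e: "0 < e"
      have "\<forall>i. \<exists>C U. closed C \<and> open U \<and> C \<subseteq> a i \<and> a i \<subseteq> U \<and> measure M (U - C) < e / 2 * (1/2)^Suc i"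
    proof
      fix i
      have "0 < e / 2 * (1/2)^Suc i" using e by simp
      then show "\<exists>C U. closed C \<and> open U \<and> C \<subseteq> a i \<and> a i \<subseteq> U \<and> measure M (U - C) < e / 2 * (1/2)^Suc i"
        using Union.IH[of i] by blast
    qed
      then obtain C U where CU: "\<And>i. closed (C i)" "\<And>i. open (U i)" "\<And>i. C i \<subseteq> a i"
          "\<And>i. a i \<subseteq> U i" "\<And>i. measure M (U i - C i) < e / 2 * (1/2)^Suc i"
        by metis
      have sums: "(\<lambda>i. e / 2 * (1/2)^Suc i) sums (e / 2 * 1)"
        by (intro sums_mult power_half_series)
      have summ: "summable (\<lambda>i. measure M (U i - C i))"
        using CU(5) by (intro summable_comparison_test'[OF sums_summable[OF sums]]) (auto intro: less_imp_le)
      have "measure M (\<Union>i. U i - C i) \<le> (\<Sum>i. measure M (U i - C i))"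
        using CU(1,2) summ by (intro finite_measure_subadditive_countably) auto
      also have "\<dots> \<le> (\<Sum>i. e / 2 * (1/2)^Suc i)"
        using CU(5) by (intro suminf_le summ sums_summable[OF sums]) (auto intro: less_imp_le)
      also have "\<dots> = e / 2" using sums by (simp add: sums_iff)
      finally have lim: "measure M (\<Union>i. U i - C i) < e" using e by simp
      define D where "D n = (\<Union>i. U i) - (\<Union>i\<le>n. C i)" for n
      have "D n \<in> sets M" for n
        using CU(1,2) unfolding D_def by (intro sets.Diff sets.finite_UN sets.countable_UN) auto
      moreover have "decseq D"
        unfolding D_def decseq_def by (intro allI impI Diff_mono UN_mono) auto
      ultimately have "(\<lambda>n. measure M (D n)) \<longlonglongrightarrow> measure M (\<Inter>n. D n)"
        using finite_Lim_measure_decseq[of D] by (simp add: image_subset_iff)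
      moreover have "measure M (\<Inter>n. D n) \<le> measure M (\<Union>i. U i - C i)"
      proof (rule finite_measure_mono)
        show "(\<Inter>n. D n) \<subseteq> (\<Union>i. U i - C i)" 
        proof
          fix x assume x: "x \<in> (\<Inter>n. D n)"
          then have "x \<in> D 0" by blast
          then obtain i where "x \<in> U i" by (auto simp: D_def)
          moreover have "x \<in> D i" using x by blast
          ultimately show "x \<in> (\<Union>i. U i - C i)" by (auto simp: D_def)
        qed
        show "(\<Union>i. U i - C i) \<in> sets M" using CU(1,2) by (intro sets.countable_UN) auto
      qed
      ultimately have "\<forall>\<^sub>F n in sequentially. measure M (D n) < e"
        using lim order_tendstoD(2) le_less_trans by blast
      then obtain n where n: "measure M (D n) < e"
        using eventually_happens' sequentially_bot by blast
      then show "\<exists>C U. closed C \<and> open U \<and> C \<subseteq> (\<Union>i. a i) \<and> (\<Union>i. a i) \<subseteq> U \<and> measure M (U - C) < e"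
      proof (intro exI conjI)
        show "closed (\<Union>i\<le>n. C i)" "open (\<Union>i. U i)" using CU(1,2) by auto
        show "(\<Union>i\<le>n. C i) \<subseteq> (\<Union>i. a i)" "(\<Union>i. a i) \<subseteq> (\<Union>i. U i)" using CU(3,4) by blast+
        show "measure M ((\<Union>i. U i) - (\<Union>i\<le>n. C i)) < e" using n by (simp add: D_def)
      qed
    qed
  qed
  then show thesis using e that by blast
qed

lemma finite_borel_measure_le_by_closed:
  fixes M M' :: "'x::{second_countable_topology, t2_space} measure"
  assumes cpt: "compact (UNIV :: 'x set)" and M: "finite_measure M" "sets M = sets borel"
    and M': "finite_measure M'" "sets M' = sets borel"
    and le: "\<And>C. closed C \<Longrightarrow> C \<subseteq> A \<Longrightarrow> measure M C \<le> measure M' C"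
    and A: "A \<in> sets borel"
  shows "measure M A \<le> measure M' A"
proof (rule field_le_epsilon)
  fix e :: real assume "0 < e"
  obtain C U where CU: "closed C" "open U" "C \<subseteq> A" "A \<subseteq> U" "measure M (U - C) < e"
    by (rule finite_borel_measure_regular[OF cpt M A \<open>0 < e\<close>])
  interpret M: finite_measure M by fact
  interpret M': finite_measure M' by fact
  have [simp]: "A \<in> sets M" "A \<in> sets M'" "C \<in> sets M" "U \<in> sets M" using A M M' CU by auto
  have "measure M A = measure M C + measure M (A - C)"
    using CU by (subst M.finite_measure_Diff) auto
  also have "measure M (A - C) \<le> measure M (U - C)"
    using CU by (intro M.finite_measure_mono) auto
  finally have "measure M A \<le> measure M C + e" using CU by simp
  also have "measure M C \<le> measure M' C" using le CU by simp
  also have "\<dots> \<le> measure M' A" using CU by (intro M'.finite_measure_mono) auto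
  finally show "measure M A \<le> measure M' A + e" by simp
qed

text \<open>
  Urysohn functions between a closed set and an open neighbourhood of almost the same measure
  show that the integrals of continuous functions determine the measure of closed sets.
\<close>

lemma finite_borel_measure_eqI_continuous:
  fixes M M' :: "'x::{second_countable_topology, t2_space} measure"
  assumes cpt: "compact (UNIV :: 'x set)" and M: "finite_measure M" "sets M = sets borel"
    and M': "finite_measure M'" "sets M' = sets borel"
    and eq: "\<And>f :: 'x \<Rightarrow> real. continuous_on UNIV f \<Longrightarrow> (\<integral>x. f x \<partial>M) = (\<integral>x. f x \<partial>M')"
  shows "M = M'"
proof -
  have le: "measure M C \<le> measure M' C"
    if M: "finite_measure M" "sets M = sets borel"
      and M': "finite_measure M'" "sets M' = sets borel"
      and eq: "\<And>f :: 'x \<Rightarrow> real. continuous_on UNIV f \<Longrightarrow> (\<integral>x. f x \<partial>M) = (\<integral>x. f x \<partial>M')"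
      and C: "closed C" for M M' :: "'x measure" and C
  proof (rule field_le_epsilon)
    fix e :: real assume "0 < e"
    obtain C' U where CU: "closed C'" "open U" "C' \<subseteq> C" "C \<subseteq> U" "measure M' (U - C') < e"
      by (rule finite_borel_measure_regular[OF cpt M' borel_closed[OF C] \<open>0 < e\<close>])
    have sep: "closed (- U)" "closed C" "- U \<inter> C = {}" using C CU by auto
    obtain f :: "'x \<Rightarrow> real" where f: "continuous_on UNIV f" "\<And>x. 0 \<le> f x \<and> f x \<le> 1"
        "\<And>x. x \<in> - U \<Longrightarrow> f x = 0" "\<And>x. x \<in> C \<Longrightarrow> f x = 1"
      by (rule Urysohn_compact_t2[OF cpt sep]) (rule that, assumption+)
    interpret M: finite_measure M by fact
    interpret M': finite_measure M' by fact
    have sets [simp]: "C \<in> sets M" "C \<in> sets M'" "U \<in> sets M'" using C CU M M' by auto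
    have [measurable]: "f \<in> borel_measurable M" "f \<in> borel_measurable M'"
      using borel_measurable_continuous_onI[OF f(1)] M M' measurable_cong_sets by blast+
    have sp: "space M = UNIV" "space M' = UNIV"
      using M M' sets_eq_imp_space_eq[of _ borel] by auto
    have "measure M C = (\<integral>x. indicator C x \<partial>M)" using sp by simp
    also have "\<dots> \<le> (\<integral>x. f x \<partial>M)"
      using f(2,4) by (intro integral_mono M.integrable_const_bound[where B = 1])
        (auto intro!: borel_measurable_indicator split: split_indicator)
    also have "\<dots> = (\<integral>x. f x \<partial>M')" using eq f by simp
    also have "\<dots> \<le> (\<integral>x. indicator U x \<partial>M')"
      using f(2,3) by (intro integral_mono M'.integrable_const_bound[where B = 1])
        (auto intro!: borel_measurable_indicator split: split_indicator)
    also have "\<dots> = measure M' U" using sp by simp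
    also have "\<dots> \<le> measure M' (C \<union> (U - C))" using CU by (intro M'.finite_measure_mono) auto
    also have "\<dots> \<le> measure M' C + measure M' (U - C)"
      by (intro measure_Un_le) auto
    also have "measure M' (U - C) \<le> measure M' (U - C')"
    proof (rule M'.finite_measure_mono)
      show "U - C \<subseteq> U - C'" using \<open>C' \<subseteq> C\<close> by blast
      have "C' \<in> sets M'" using CU(1) M'(2) by simp
      then show "U - C' \<in> sets M'" using sets(3) by (intro sets.Diff)
    qed
    finally show "measure M C \<le> measure M' C + e" using CU by simp
  qed
  show ?thesis
  proof (rule measure_eqI)
    show "sets M = sets M'" using M M' by simp
    fix A assume "A \<in> sets M"
    then have A: "A \<in> sets borel" using M by simp
    have "measure M A = measure M' A"
      using finite_borel_measure_le_by_closed[OF cpt M M' le A, OF M M' eq]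
        finite_borel_measure_le_by_closed[OF cpt M' M le A, OF M' M eq[symmetric]] by force
    then show "emeasure M A = emeasure M' A"
      using M M' by (simp add: finite_measure.emeasure_eq_measure)
  qed
qed

lemma measurable_if_sets_borel:
  assumes "sets M = sets borel" "f \<in> measurable borel N"
  shows "f \<in> measurable M N"
  using assms by (simp cong: measurable_cong_sets)

section \<open>Weak compactness and existence of optimal couplings\<close>

text \<open>
  At the first differing position the terms differ by \<open>(1/3)^n\<close>, while all later ones together
  contribute at most half of that. Closeness of two such sums therefore forces equality of digits.
\<close>

lemma ternary_digit_gap:
  fixes a b :: "nat \<Rightarrow> bool"
  assumes "a i \<noteq> b i"
  shows "(1/3)^i / 2 \<le> \<bar>(\<Sum>j. of_bool (a j) * (1/3)^j) - (\<Sum>j. of_bool (b j) * (1/3::real)^j)\<bar>"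
proof -
  define n where "n = (LEAST n. a n \<noteq> b n)"
  have n: "a n \<noteq> b n" "n \<le> i" "\<And>j. j < n \<Longrightarrow> a j = b j"
    unfolding n_def using LeastI[of "\<lambda>n. a n \<noteq> b n", OF assms] Least_le[of "\<lambda>n. a n \<noteq> b n", OF assms]
      not_less_Least[of _ "\<lambda>n. a n \<noteq> b n"] by blast+
  have geo: "summable (\<lambda>j. (1/3::real)^j)" by (simp add: summable_geometric)
  have summ: "summable (\<lambda>j. of_bool (d j) * (1/3::real)^j)" for d :: "nat \<Rightarrow> bool"
    by (rule summable_comparison_test'[OF geo]) auto
  define f where "f j = (of_bool (a j) - of_bool (b j)) * (1/3::real)^j" for j
  have abs_f: "\<bar>f j\<bar> \<le> (1/3)^j" for j by (auto simp: f_def of_bool_def)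
  have sumf: "summable f" by (rule summable_comparison_test'[OF geo]) (use abs_f in auto)
  have geo': "(\<lambda>j. (1/3::real)^(j + Suc n)) sums ((1/3)^n / 2)"
    using sums_mult[OF geometric_sums[of "1/3::real"], of "(1/3)^Suc n"]
    by (simp add: power_add mult_ac)
  have sum_abs: "summable (\<lambda>j. \<bar>f (j + Suc n)\<bar>)"
  proof (rule summable_comparison_test'[OF sums_summable[OF geo']])
    show "norm \<bar>f (j + Suc n)\<bar> \<le> (1/3)^(j + Suc n)" for j
      using abs_f[of "j + Suc n"] by (simp only: real_norm_def abs_idempotent)
  qed
  have "\<bar>\<Sum>j. f (j + Suc n)\<bar> \<le> (\<Sum>j. \<bar>f (j + Suc n)\<bar>)" by (rule summable_rabs[OF sum_abs])
  also have "\<dots> \<le> (\<Sum>j. (1/3::real)^(j + Suc n))"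
    by (rule suminf_le[OF abs_f sum_abs sums_summable[OF geo']])
  also have "\<dots> = (1/3)^n / 2" using geo' by (simp add: sums_iff)
  finally have tail: "\<bar>\<Sum>j. f (j + Suc n)\<bar> \<le> (1/3)^n / 2" .
  have "(\<Sum>j<Suc n. f j) = f n" using n(3) by (simp add: f_def)
  then have "(\<Sum>j. f j) = (\<Sum>j. f (j + Suc n)) + f n"
    using suminf_split_initial_segment[OF sumf, of "Suc n"] by simp
  moreover have "\<bar>f n\<bar> = (1/3)^n" using n(1) by (auto simp: f_def)
  ultimately have "(1/3)^n / 2 \<le> \<bar>\<Sum>j. f j\<bar>" using tail by linarith
  moreover have "(1/3::real)^i \<le> (1/3)^n" using n(2) by (intro power_decreasing) auto
  moreover have "(\<Sum>j. f j) = (\<Sum>j. of_bool (a j) * (1/3)^j) - (\<Sum>j. of_bool (b j) * (1/3::real)^j)"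
    by (simp add: f_def left_diff_distrib suminf_diff[OF summ summ])
  ultimately show ?thesis by linarith
qed

text \<open>
  The code \<open>s x\<close> records in ternary digits which sets of a countable base contain \<open>x\<close>. It is in
  general not continuous, but its inverse is, and it even extends to the closure of the range:
  the closure \<open>G\<close> of the graph of \<open>s\<close>, read as a relation from reals to points, is
  compact and still single-valued, since two points over the same real would be told apart by a
  digit. A compact graph belongs to a continuous function \<open>h\<close>.
\<close>

lemma compact_t2_real_coding:
  assumes cpt: "compact (UNIV :: 'x set)"
  obtains s :: "'x::{second_countable_topology, t2_space} \<Rightarrow> real" and h :: "real \<Rightarrow> 'x" and K :: "real set"
  where "s \<in> borel_measurable borel" "compact K" "range s \<subseteq> K" "continuous_on K h" "\<And>x. h (s x) = x"
    "\<And>x. 0 \<le> s x \<and> s x \<le> 2"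
proof -
  obtain B :: "'x set set" where B: "countable B" "topological_basis B"
    using ex_countable_basis by blast
  define U where "U = from_nat_into B"
  obtain b0 where "b0 \<in> B" using topological_basisE[OF B(2) open_UNIV UNIV_I] by metis
  then have rangeU: "range U = B" unfolding U_def using B(1) by (intro range_from_nat_into) auto
  then have openU: "open (U i)" for i using B(2) topological_basis_open by blast
  have U: "\<exists>i. x \<in> U i \<and> U i \<subseteq> W" if "open W" "x \<in> W" for x W
    using topological_basisE[OF B(2) that] rangeU by (metis rangeE)
  define s where "s x = (\<Sum>j. of_bool (x \<in> U j) * (1/3::real)^j)" for x
  have geo: "summable (\<lambda>j. (1/3::real)^j)" by (simp add: summable_geometric)
  have summ: "summable (\<lambda>j. of_bool (x \<in> U j) * (1/3::real)^j)" for x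
    by (rule summable_comparison_test'[OF geo]) auto
  have s_meas: "s \<in> borel_measurable borel"
  proof -
    have "(\<lambda>x. indicator (U j) x * (1/3::real)^j) \<in> borel_measurable borel" for j
      using openU by (intro borel_measurable_times borel_measurable_indicator borel_measurable_const) auto
    then have "(\<lambda>x. \<Sum>j. indicator (U j) x * (1/3::real)^j) \<in> borel_measurable borel"
      by (rule borel_measurable_suminf)
    then show ?thesis by (simp add: s_def[abs_def] indicator_def of_bool_def)
  qed
  have s_bd: "0 \<le> s x \<and> s x \<le> 2" for x
  proof
    show "0 \<le> s x" unfolding s_def by (intro suminf_nonneg summ) auto
    have "s x \<le> (\<Sum>j. (1/3::real)^j)" unfolding s_def by (intro suminf_le summ geo) auto
    also have "\<dots> \<le> 2" by (subst suminf_geometric) auto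
    finally show "s x \<le> 2" .
  qed
  define G where "G = closure (range (\<lambda>x. (s x, x)))"
  have "G \<subseteq> {0..2} \<times> UNIV"
    unfolding G_def using s_bd by (intro closure_minimal closed_Times) auto
  then have "G = ({0..2} \<times> UNIV) \<inter> G" by auto
  also have "compact \<dots>"
    by (intro compact_Int_closed compact_Times cpt) (auto simp: G_def)
  finally have cptG: "compact G" .
  have graph: "(s x, x) \<in> G" for x unfolding G_def by (rule subsetD[OF closure_subset]) auto
  have uniq: "p = q" if tp: "(t, p) \<in> G" and tq: "(t, q) \<in> G" for t p q
  proof (rule ccontr)
    assume "p \<noteq> q"
    then obtain W V where WV: "open W" "open V" "p \<in> W" "q \<in> V" "W \<inter> V = {}"
      using hausdorff by metis
    obtain i where i: "p \<in> U i" "U i \<subseteq> W" using U WV by blast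
    define \<delta> where "\<delta> = (1/3::real)^i / 4"
    have \<delta>: "\<delta> > 0" by (simp add: \<delta>_def)
    have near: "\<exists>x. s x \<in> ball t \<delta> \<and> x \<in> A" if "(t, r) \<in> G" "open A" "r \<in> A" for r A
    proof -
      have "open (ball t \<delta> \<times> A)" "(t, r) \<in> ball t \<delta> \<times> A"
        using that \<delta> by (auto intro: open_Times)
      then have "(ball t \<delta> \<times> A) \<inter> range (\<lambda>x. (s x, x)) \<noteq> {}"
        using that(1) open_Int_closure_eq_empty unfolding G_def by blast
      then show ?thesis by auto
    qed
    obtain x where x: "s x \<in> ball t \<delta>" "x \<in> U i" using near[OF tp openU i(1)] by blast
    obtain y where y: "s y \<in> ball t \<delta>" "y \<in> V" using near[OF tq WV(2,4)] by blast
    have "\<bar>s x - s y\<bar> < 2 * \<delta>" using x(1) y(1) by (auto simp: dist_real_def)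
    moreover have "(x \<in> U i) \<noteq> (y \<in> U i)" using x y i WV by auto
    from ternary_digit_gap[of "\<lambda>i. x \<in> U i" i "\<lambda>i. y \<in> U i", OF this]
    have "(1/3)^i / 2 \<le> \<bar>s x - s y\<bar>" by (simp add: s_def)
    ultimately show False by (simp add: \<delta>_def)
  qed
  define h where "h t = (SOME p. (t, p) \<in> G)" for t
  have h: "(t, h t) \<in> G" if "t \<in> fst ` G" for t
    using that unfolding h_def by (auto intro: someI)
  have cptK: "compact (fst ` G)" by (intro compact_continuous_image cptG continuous_intros)
  show thesis
  proof
    show "s \<in> borel_measurable borel" "compact (fst ` G)" by fact+
    show "range s \<subseteq> fst ` G" using graph by force
    show "h (s x) = x" for x
    proof -
      have "s x \<in> fst ` G" using graph[of x] by force
      then show ?thesis by (rule uniq[OF h graph])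
    qed
    show "0 \<le> s x \<and> s x \<le> 2" for x by (rule s_bd)
    show "continuous_on (fst ` G) h"
      unfolding continuous_on_closed_vimage[OF compact_imp_closed[OF cptK]]
    proof (intro allI impI)
      fix C :: "'x set" assume C: "closed C"
      have "h -` C \<inter> fst ` G = fst ` (G \<inter> (UNIV \<times> C))"
      proof (intro set_eqI iffI)
        fix t assume "t \<in> h -` C \<inter> fst ` G"
        then have "(t, h t) \<in> G \<inter> (UNIV \<times> C)" using h by auto
        then show "t \<in> fst ` (G \<inter> (UNIV \<times> C))" by force
      next
        fix t assume "t \<in> fst ` (G \<inter> (UNIV \<times> C))"
        then obtain p where p: "(t, p) \<in> G" "p \<in> C" by auto
        then have "t \<in> fst ` G" by force
        moreover from this have "h t = p" using uniq[OF h p(1)] by simp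
        ultimately show "t \<in> h -` C \<inter> fst ` G" using p(2) by simp
      qed
      also have "compact \<dots>"
        using C by (intro compact_continuous_image compact_Int_closed cptG continuous_intros closed_Times) auto
      finally show "closed (h -` C \<inter> fst ` G)" by (rule compact_imp_closed)
    qed
  qed
qed

text \<open>
  The measures are moved to the real line by the Borel code \<open>s\<close>, where they are supported
  in a bounded interval and hence tight; the limit is carried back by \<open>h\<close>. Weak convergence survives although \<open>s\<close>
  is discontinuous, because a continuous \<open>f\<close> on the space turns into the function \<open>f \<circ> h\<close> on
  the compact set \<open>K\<close>, which extends continuously to all reals and pulls back under \<open>s\<close> to \<open>f\<close>.
\<close>

lemma prob_measures_sequentially_compact:
  fixes \<gamma> :: "nat \<Rightarrow> 'x::{second_countable_topology, t2_space} measure"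
  assumes cpt: "compact (UNIV :: 'x set)"
    and \<gamma>: "\<And>n. prob_space (\<gamma> n)" "\<And>n. sets (\<gamma> n) = sets borel"
  obtains r \<gamma>' where "strict_mono (r :: nat \<Rightarrow> nat)" "prob_space \<gamma>'" "sets \<gamma>' = sets borel"
    "\<And>f :: 'x \<Rightarrow> real. continuous_on UNIV f \<Longrightarrow> (\<lambda>n. \<integral>x. f x \<partial>\<gamma> (r n)) \<longlonglongrightarrow> (\<integral>x. f x \<partial>\<gamma>')"
proof -
  obtain s :: "'x \<Rightarrow> real" and h K where s [measurable]: "s \<in> borel_measurable borel" and K: "compact K"
    and sK: "range s \<subseteq> K" and h: "continuous_on K h" and hs: "\<And>x. h (s x) = x" and s_bd: "\<And>x. 0 \<le> s x \<and> s x \<le> 2"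
    by (rule compact_t2_real_coding[OF cpt])
      (rule that, assumption+)
  have s_meas [measurable]: "s \<in> borel_measurable (\<gamma> n)" for n
    by (rule measurable_if_sets_borel[OF \<gamma>(2) s])
  have sp: "space (\<gamma> n) = UNIV" for n using sets_eq_imp_space_eq[OF \<gamma>(2)] by simp
  define \<kappa> where "\<kappa> n = distr (\<gamma> n) borel s" for n
  have rd: "real_distribution (\<kappa> n)" for n
    unfolding \<kappa>_def real_distribution_def real_distribution_axioms_def
    using prob_space.prob_space_distr[OF \<gamma>(1) s_meas] by simp
  have int_\<kappa>: "(\<integral>t. F t \<partial>\<kappa> n) = (\<integral>x. F (s x) \<partial>\<gamma> n)" if "F \<in> borel_measurable borel" for F :: "real \<Rightarrow> real" and n
    unfolding \<kappa>_def by (rule integral_distr) (use that in auto)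
  have "measure (\<kappa> n) {-1<..2} = 1" for n
  proof -
    have "s -` {-1<..2} \<inter> space (\<gamma> n) = space (\<gamma> n)"
    proof -
      have "-1 < s x" "s x \<le> 2" for x using s_bd[of x] by auto
      then show ?thesis by auto
    qed
    then show ?thesis
      unfolding \<kappa>_def by (subst measure_distr) (auto simp: prob_space.prob_space[OF \<gamma>(1)])
  qed
  then have "tight \<kappa>"
    unfolding tight_def using rd by (intro conjI allI impI exI[of _ "-1"] exI[of _ 2]) auto
  then obtain r \<kappa>' where r: "strict_mono (r :: nat \<Rightarrow> nat)" and \<kappa>': "real_distribution \<kappa>'"
    and wc: "weak_conv_m (\<kappa> \<circ> id \<circ> r) \<kappa>'"
    using tight_imp_convergent_subsubsequence[OF _ strict_mono_id] by blast
  interpret \<kappa>': real_distribution \<kappa>' by fact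
  have lim: "(\<lambda>n. \<integral>x. F (s x) \<partial>\<gamma> (r n)) \<longlonglongrightarrow> (\<integral>t. F t \<partial>\<kappa>')"
    if F: "continuous_on UNIV F" "\<And>t. \<bar>F t\<bar> \<le> B" for F :: "real \<Rightarrow> real" and B
  proof -
    have "(\<lambda>n. \<integral>t. F t \<partial>(\<kappa> \<circ> id \<circ> r) n) \<longlonglongrightarrow> (\<integral>t. F t \<partial>\<kappa>')"
    proof (rule weak_conv_imp_integral_bdd_continuous_conv[OF _ \<kappa>' wc])
      show "real_distribution ((\<kappa> \<circ> id \<circ> r) n)" for n using rd by simp
      show "isCont F t" for t using F(1) by (simp add: continuous_on_eq_continuous_at)
      show "norm (F t) \<le> B" for t using F(2) by simp
    qed
    moreover have "F \<in> borel_measurable borel" using F(1) by (rule borel_measurable_continuous_onI)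
    ultimately show ?thesis by (simp add: int_\<kappa>)
  qed
  have "K \<noteq> {}" using sK by auto
  have clK: "closed K" using K by (rule compact_imp_closed)
  \<comment> \<open>The limit lives on \<open>K\<close>: the truncated distance to \<open>K\<close> has integral 0 along the sequence.\<close>
  have AE_K: "AE t in \<kappa>'. t \<in> K"
  proof -
    define F where "F t = min 1 (infdist t K)" for t
    have F: "continuous_on UNIV F" unfolding F_def by (intro continuous_intros)
    have F_bd: "\<bar>F t\<bar> \<le> 1" "0 \<le> F t" for t by (auto simp: F_def infdist_nonneg)
    have F_meas: "F \<in> borel_measurable \<kappa>'"
      using borel_measurable_continuous_onI[OF F] by simp
    have "s x \<in> K" for x using sK by auto
    then have "F (s x) = 0" for x by (simp add: F_def)
    then have "(\<integral>t. F t \<partial>\<kappa>') = 0" using LIMSEQ_unique[OF lim[OF F F_bd(1)], of 0] by simp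
    then have "AE t in \<kappa>'. F t = 0"
      using F_bd F_meas by (subst integral_nonneg_eq_0_iff_AE[symmetric])
        (auto intro!: \<kappa>'.integrable_const_bound[where B = 1])
    then show ?thesis
    proof eventually_elim
      case (elim t)
      then have "infdist t K = 0" by (auto simp: F_def min_def split: if_splits)
      then show ?case using in_closed_iff_infdist_zero[OF clK \<open>K \<noteq> {}\<close>] by simp
    qed
  qed
  define h' where "h' t = (if t \<in> K then h t else undefined)" for t
  have h'_meas: "h' \<in> borel_measurable \<kappa>'"
  proof -
    have "h' \<in> borel_measurable borel"
      unfolding h'_def using clK h by (intro borel_measurable_continuous_on_if) auto
    then show ?thesis by (simp cong: measurable_cong_sets)
  qed
  show thesis
  proof (rule that[of r "distr \<kappa>' borel h'"])
    show "prob_space (distr \<kappa>' borel h')" by (rule \<kappa>'.prob_space_distr[OF h'_meas])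
    fix f :: "'x \<Rightarrow> real" assume f: "continuous_on UNIV f"
    have "bounded (range f)" using compact_continuous_image[OF f cpt] by (rule compact_imp_bounded)
    then obtain B where B: "\<And>x. \<bar>f x\<bar> \<le> B" by (auto simp: bounded_iff)
    have "0 \<le> B" using B[of undefined] by linarith
    have fh: "continuous_on K (\<lambda>t. f (h t))"
      using f h by (intro continuous_on_compose2[OF f h]) auto
    obtain F where F: "continuous_on UNIV F" "\<And>t. t \<in> K \<Longrightarrow> F t = f (h t)" "\<And>t. t \<in> UNIV \<Longrightarrow> norm (F t) \<le> B"
      by (rule Tietze[OF fh, of UNIV B]) (use clK \<open>0 \<le> B\<close> B in auto)
    have f_meas: "f \<in> borel_measurable borel" using f by (rule borel_measurable_continuous_onI)
    have "(\<integral>t. F t \<partial>\<kappa>') = (\<integral>t. f (h' t) \<partial>\<kappa>')"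
    proof (rule integral_cong_AE)
      show "F \<in> borel_measurable \<kappa>'" using borel_measurable_continuous_onI[OF F(1)] by simp
      show "(\<lambda>t. f (h' t)) \<in> borel_measurable \<kappa>'" using h'_meas f_meas by measurable
      show "AE t in \<kappa>'. F t = f (h' t)"
        using AE_K by eventually_elim (simp add: F h'_def)
    qed
    also have "\<dots> = (\<integral>x. f x \<partial>distr \<kappa>' borel h')"
      using h'_meas f_meas by (intro integral_distr[symmetric])
    finally have "(\<integral>t. F t \<partial>\<kappa>') = (\<integral>x. f x \<partial>distr \<kappa>' borel h')" .
    moreover have "F (s x) = f x" for x using sK F(2)[of "s x"] hs[of x] by (simp add: image_subset_iff)
    ultimately show "(\<lambda>n. \<integral>x. f x \<partial>\<gamma> (r n)) \<longlonglongrightarrow> (\<integral>x. f x \<partial>distr \<kappa>' borel h')"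
      using lim[OF F(1), of B] F(3) by simp
  qed (use r in auto)
qed

lemma measurable_borel_fst_snd:
  "fst \<in> borel_measurable (borel :: ('a::{second_countable_topology} \<times> 'b::{second_countable_topology}) measure)"
  "snd \<in> borel_measurable (borel :: ('a \<times> 'b) measure)"
  by (intro borel_measurable_continuous_onI continuous_intros)+

lemma coupling_prob_space:
  fixes \<mu> :: "'a::second_countable_topology measure" and \<nu> :: "'b::second_countable_topology measure"
  assumes "\<gamma> \<in> couplings \<mu> \<nu>" "prob_space \<mu>"
  shows "prob_space \<gamma>"
proof (rule prob_space_distrD)
  show "fst \<in> measurable \<gamma> borel"
    using assms by (intro measurable_if_sets_borel[OF _ measurable_borel_fst_snd(1)]) (simp add: couplings_def)
  show "prob_space (distr \<gamma> borel fst)" using assms by (simp add: couplings_def)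
qed

lemma product_in_couplings:
  fixes \<mu> :: "'a::second_countable_topology measure" and \<nu> :: "'b::second_countable_topology measure"
  assumes "prob_space \<mu>" "prob_space \<nu>" "sets \<mu> = sets borel" "sets \<nu> = sets borel"
  shows "\<mu> \<Otimes>\<^sub>M \<nu> \<in> couplings \<mu> \<nu>"
proof -
  interpret \<mu>: prob_space \<mu> by fact
  interpret \<nu>: prob_space \<nu> by fact
  interpret pair_prob_space \<mu> \<nu> ..
  have "distr (\<mu> \<Otimes>\<^sub>M \<nu>) borel fst = distr (\<mu> \<Otimes>\<^sub>M \<nu>) \<mu> fst"
    using assms by (intro distr_cong) auto
  moreover have "distr (\<mu> \<Otimes>\<^sub>M \<nu>) borel snd = distr (\<mu> \<Otimes>\<^sub>M \<nu>) \<nu> snd"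
    using assms by (intro distr_cong) auto
  moreover have "distr (\<mu> \<Otimes>\<^sub>M \<nu>) \<mu> fst = \<mu>" by (rule \<nu>.distr_pair_fst)
  moreover have "distr (\<mu> \<Otimes>\<^sub>M \<nu>) \<nu> snd = \<nu>"
  proof (rule measure_eqI)
    fix A assume "A \<in> sets (distr (\<mu> \<Otimes>\<^sub>M \<nu>) \<nu> snd)"
    then have A: "A \<in> sets \<nu>" by simp
    have "emeasure (distr (\<mu> \<Otimes>\<^sub>M \<nu>) \<nu> snd) A = emeasure (\<mu> \<Otimes>\<^sub>M \<nu>) (space \<mu> \<times> A)"
      using A sets.sets_into_space[OF A]
      by (subst emeasure_distr) (auto intro!: arg_cong[where f = "emeasure _"] simp: space_pair_measure)
    then show "emeasure (distr (\<mu> \<Otimes>\<^sub>M \<nu>) \<nu> snd) A = emeasure \<nu> A"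
      using A by (simp add: \<nu>.emeasure_pair_measure_Times \<mu>.emeasure_space_1)
  qed simp
  moreover have "sets (\<mu> \<Otimes>\<^sub>M \<nu>) = sets borel"
    using sets_pair_measure_cong[OF assms(3,4)] unfolding borel_prod .
  ultimately show ?thesis by (simp add: couplings_def)
qed

text \<open>
  A limit of a minimizing sequence: both marginals and the cost are integrals of continuous
  functions, so they pass to the limit.
\<close>

lemma optimal_coupling_exists:
  fixes \<mu> :: "'a::{second_countable_topology, t2_space} measure"
    and \<nu> :: "'b::{second_countable_topology, t2_space} measure"
    and c :: "'a \<times> 'b \<Rightarrow> real"
  assumes cpt: "compact (UNIV :: 'a set)" "compact (UNIV :: 'b set)" and c: "continuous_on UNIV c"
    and \<mu>: "prob_space \<mu>" "sets \<mu> = sets borel" and \<nu>: "prob_space \<nu>" "sets \<nu> = sets borel"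
  shows "optimal_couplings c \<mu> \<nu> \<noteq> {}"
proof -
  have cpt_prod: "compact (UNIV :: ('a \<times> 'b) set)"
    using compact_Times[OF cpt] by simp
  have "bounded (range c)" using compact_continuous_image[OF c cpt_prod] by (rule compact_imp_bounded)
  then obtain B where B: "\<And>z. \<bar>c z\<bar> \<le> B" by (auto simp: bounded_iff)
  have B0: "0 \<le> B" using B[of undefined] by linarith
  define V where "V = (\<lambda>\<gamma>. \<integral>p. c p \<partial>\<gamma>) ` couplings \<mu> \<nu>"
  have c_meas: "c \<in> borel_measurable \<gamma>" if "\<gamma> \<in> couplings \<mu> \<nu>" for \<gamma>
    using that by (intro measurable_if_sets_borel[OF _ borel_measurable_continuous_onI[OF c]])
      (simp add: couplings_def)
  have "V \<noteq> {}" unfolding V_def using product_in_couplings[OF \<mu>(1) \<nu>(1) \<mu>(2) \<nu>(2)] by auto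
  have "bdd_below V"
  proof (rule bdd_belowI)
    fix v assume "v \<in> V"
    then obtain \<gamma> where \<gamma>: "\<gamma> \<in> couplings \<mu> \<nu>" "v = (\<integral>p. c p \<partial>\<gamma>)" by (auto simp: V_def)
    interpret prob_space \<gamma> by (rule coupling_prob_space[OF \<gamma>(1) \<mu>(1)])
    have "(\<integral>p. -B \<partial>\<gamma>) \<le> (\<integral>p. c p \<partial>\<gamma>)"
      using B c_meas[OF \<gamma>(1)] by (intro integral_mono integrable_const_bound[where B = B])
        (auto simp: abs_le_iff minus_le_iff B0)
    then show "-B \<le> v" using \<gamma> prob_space by simp
  qed
  have "\<exists>\<gamma>\<in>couplings \<mu> \<nu>. (\<integral>p. c p \<partial>\<gamma>) < Inf V + 1 / Suc n" for n
    using cInf_lessD[OF \<open>V \<noteq> {}\<close>, of "Inf V + 1 / Suc n"] by (auto simp: V_def)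
  then obtain \<gamma> where \<gamma>: "\<And>n. \<gamma> n \<in> couplings \<mu> \<nu>" "\<And>n. (\<integral>p. c p \<partial>\<gamma> n) < Inf V + 1 / Suc n"
    by metis
  have ps: "prob_space (\<gamma> n)" "sets (\<gamma> n) = sets borel" for n
    using coupling_prob_space[OF \<gamma>(1) \<mu>(1)] \<gamma>(1)[of n] by (simp_all add: couplings_def)
  obtain r \<gamma>' where r: "strict_mono (r :: nat \<Rightarrow> nat)" and \<gamma>': "prob_space \<gamma>'" "sets \<gamma>' = sets borel"
    and lim: "\<And>f :: 'a \<times> 'b \<Rightarrow> real. continuous_on UNIV f \<Longrightarrow> (\<lambda>n. \<integral>x. f x \<partial>\<gamma> (r n)) \<longlonglongrightarrow> (\<integral>x. f x \<partial>\<gamma>')"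
    by (rule prob_measures_sequentially_compact[OF cpt_prod ps]) (rule that, assumption+)
  interpret \<gamma>': prob_space \<gamma>' by fact
  have proj [measurable]: "fst \<in> borel_measurable \<gamma>'" "snd \<in> borel_measurable \<gamma>'"
    "fst \<in> borel_measurable (\<gamma> n)" "snd \<in> borel_measurable (\<gamma> n)" for n
    by (rule measurable_if_sets_borel[OF \<gamma>'(2)] measurable_if_sets_borel[OF ps(2)],
        rule measurable_borel_fst_snd)+
  have fin: "finite_measure \<mu>" "finite_measure \<nu>" using \<mu>(1) \<nu>(1) by (auto simp: prob_space_def)
  have "distr \<gamma>' borel fst = \<mu>"
  proof (rule finite_borel_measure_eqI_continuous[OF cpt(1)])
    show "finite_measure (distr \<gamma>' borel fst)" by (rule \<gamma>'.finite_measure_distr) simp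
    fix f :: "'a \<Rightarrow> real" assume f: "continuous_on UNIV f"
    have [measurable]: "f \<in> borel_measurable borel" using f by (rule borel_measurable_continuous_onI)
    have "(\<integral>p. f (fst p) \<partial>\<gamma> n) = (\<integral>x. f x \<partial>\<mu>)" for n
      using \<gamma>(1)[of n] integral_distr[of fst "\<gamma> n" borel f] by (simp add: couplings_def)
    moreover have "continuous_on UNIV (\<lambda>p::'a \<times> 'b. f (fst p))"
      by (rule continuous_on_compose2[OF f]) (auto intro: continuous_intros)
    ultimately have "(\<integral>p. f (fst p) \<partial>\<gamma>') = (\<integral>x. f x \<partial>\<mu>)"
      using lim[of "\<lambda>p. f (fst p)"] by (simp add: LIMSEQ_const_iff)
    then show "(\<integral>x. f x \<partial>distr \<gamma>' borel fst) = (\<integral>x. f x \<partial>\<mu>)"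
      by (subst integral_distr) auto
  qed (use \<mu> fin in auto)
  moreover have "distr \<gamma>' borel snd = \<nu>"
  proof (rule finite_borel_measure_eqI_continuous[OF cpt(2)])
    show "finite_measure (distr \<gamma>' borel snd)" by (rule \<gamma>'.finite_measure_distr) simp
    fix f :: "'b \<Rightarrow> real" assume f: "continuous_on UNIV f"
    have [measurable]: "f \<in> borel_measurable borel" using f by (rule borel_measurable_continuous_onI)
    have "(\<integral>p. f (snd p) \<partial>\<gamma> n) = (\<integral>x. f x \<partial>\<nu>)" for n
      using \<gamma>(1)[of n] integral_distr[of snd "\<gamma> n" borel f] by (simp add: couplings_def)
    moreover have "continuous_on UNIV (\<lambda>p::'a \<times> 'b. f (snd p))"
      by (rule continuous_on_compose2[OF f]) (auto intro: continuous_intros)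
    ultimately have "(\<integral>p. f (snd p) \<partial>\<gamma>') = (\<integral>x. f x \<partial>\<nu>)"
      using lim[of "\<lambda>p. f (snd p)"] by (simp add: LIMSEQ_const_iff)
    then show "(\<integral>x. f x \<partial>distr \<gamma>' borel snd) = (\<integral>x. f x \<partial>\<nu>)"
      by (subst integral_distr) auto
  qed (use \<nu> fin in auto)
  ultimately have mem: "\<gamma>' \<in> couplings \<mu> \<nu>" using \<gamma>' by (simp add: couplings_def)
  have "(\<lambda>n. 1 / real (Suc n)) \<longlonglongrightarrow> 0" by (rule LIMSEQ_Suc[OF lim_1_over_n])
  then have "(\<lambda>n. Inf V + 1 / real (Suc n)) \<longlonglongrightarrow> Inf V" using tendsto_add[OF tendsto_const] by fastforce
  then have "(\<lambda>n. Inf V + 1 / real (Suc (r n))) \<longlonglongrightarrow> Inf V"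
    using LIMSEQ_subseq_LIMSEQ[OF _ r] by (fastforce simp: o_def)
  then have "(\<integral>p. c p \<partial>\<gamma>') \<le> Inf V"
    using lim[OF c] \<gamma>(2) by (intro LIMSEQ_le) (auto intro: less_imp_le)
  moreover have "Inf V \<le> (\<integral>p. c p \<partial>\<gamma>)" if "\<gamma> \<in> couplings \<mu> \<nu>" for \<gamma>
    using that \<open>bdd_below V\<close> by (intro cInf_lower) (auto simp: V_def)
  ultimately have "\<gamma>' \<in> optimal_couplings c \<mu> \<nu>"
    using mem by (force simp: optimal_couplings_def is_arg_min_def)
  then show ?thesis by auto
qed

section \<open>Supports of optimal couplings are cyclically monotone\<close>

definition measure_support :: "'x::topological_space measure \<Rightarrow> 'x set" where
  "measure_support M = {z. \<forall>U. open U \<longrightarrow> z \<in> U \<longrightarrow> 0 < measure M U}"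

lemma closed_measure_support: "closed (measure_support M)"
proof -
  have "- measure_support M = \<Union>{U. open U \<and> \<not> 0 < measure M U}"
    by (auto simp: measure_support_def)
  also have "open \<dots>" by (intro open_Union) auto
  finally show ?thesis by (simp add: closed_def)
qed

text \<open>
  The complement is a union of open null sets, of which countably many suffice.
\<close>

lemma null_sets_Compl_measure_support:
  fixes M :: "'x::second_countable_topology measure"
  assumes "finite_measure M" "sets M = sets borel"
  shows "- measure_support M \<in> null_sets M"
proof -
  interpret finite_measure M by fact
  define \<U> where "\<U> = {U. open U \<and> \<not> 0 < measure M U}"
  have "- measure_support M = \<Union>\<U>"
    by (auto simp: measure_support_def \<U>_def)
  moreover obtain \<U>' where "\<U>' \<subseteq> \<U>" "countable \<U>'" "\<Union>\<U>' = \<Union>\<U>"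
    using Lindelof[of \<U>] by (auto simp: \<U>_def)
  moreover have "U \<in> null_sets M" if "U \<in> \<U>" for U
    using that assms(2) by (intro null_setsI) (auto simp: \<U>_def emeasure_eq_measure zero_less_measure_iff)
  ultimately show ?thesis
    using null_sets_UN'[of \<U>' "\<lambda>U. U" M] by (metis image_ident subsetD)
qed

lemma sum_Suc_mod: "(\<Sum>i<I. f (Suc i mod I)) = (\<Sum>i<I. f i)" for f :: "nat \<Rightarrow> 'z::comm_monoid_add"
proof (cases I)
  case (Suc m)
  have "(\<Sum>i<Suc m. f (Suc i mod Suc m)) = (\<Sum>i<m. f (Suc i)) + f 0" by simp
  also have "\<dots> = (\<Sum>i<Suc m. f i)" by (simp add: sum.lessThan_Suc_shift add.commute del: sum.lessThan_Suc)
  finally show ?thesis using Suc by simp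
qed simp

text \<open>
  Suppose a cycle \<open>(x i, y i)\<close> has negative gain, with \<open>(x i, y i)\<close> in the support of the optimal
  coupling \<open>\<Gamma> i\<close>. Sample \<open>Z i\<close> independently from \<open>\<Gamma> i\<close>. If every \<open>Z i\<close> falls into a small
  neighbourhood \<open>X i\<close> of \<open>(x i, y i)\<close>, which has positive probability, shift the first
  coordinates cyclically; otherwise change nothing. A uniformly chosen member of the
  resulting family \<open>W\<close> is distributed according to a coupling of \<open>\<mu>\<close> and \<open>\<nu>\<close>, since the shift merely permutes the first
  coordinates, and its expected cost is below the average of the costs of the \<open>\<Gamma> i\<close>, all
  of which are minimal. Sampling from several couplings at once gives the statement for the union of
  all supports, and no mass has to be subtracted from a measure.
\<close>

theorem union_supports_cyclically_monotone:
  fixes \<mu> :: "'a::{second_countable_topology, t2_space} measure"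
    and \<nu> :: "'b::{second_countable_topology, t2_space} measure"
    and c :: "'a \<times> 'b \<Rightarrow> real"
  assumes cpt: "compact (UNIV :: 'a set)" "compact (UNIV :: 'b set)" and c: "continuous_on UNIV c"
    and \<mu>: "prob_space \<mu>" "sets \<mu> = sets borel" and \<nu>: "prob_space \<nu>" "sets \<nu> = sets borel"
  shows "cyclically_monotone c (\<Union>\<gamma>\<in>optimal_couplings c \<mu> \<nu>. measure_support \<gamma>)"
  unfolding cyclically_monotone_def
proof (intro allI impI)
  fix I :: nat and x y
  assume I: "1 \<le> I" and xy: "\<forall>i<I. (x i, y i) \<in> (\<Union>\<gamma>\<in>optimal_couplings c \<mu> \<nu>. measure_support \<gamma>)"
  have J_ne: "{..<I} \<noteq> {}" using I by (metis lessThan_iff empty_iff less_le_trans zero_less_one)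
  have cpt_prod: "compact (UNIV :: ('a \<times> 'b) set)"
    using compact_Times[OF cpt] by simp
  have "\<forall>i. \<exists>\<gamma>\<in>optimal_couplings c \<mu> \<nu>. i < I \<longrightarrow> (x i, y i) \<in> measure_support \<gamma>"
    using xy I by (metis UN_E less_le_trans zero_less_one)
  then obtain \<Gamma> where \<Gamma>: "\<And>i. \<Gamma> i \<in> optimal_couplings c \<mu> \<nu>"
      "\<And>i. i < I \<Longrightarrow> (x i, y i) \<in> measure_support (\<Gamma> i)"
    by metis
  have coup: "\<Gamma> i \<in> couplings \<mu> \<nu>" for i
    using \<Gamma>(1)[of i] by (simp add: optimal_couplings_def is_arg_min_def)
  have opt: "(\<integral>p. c p \<partial>\<Gamma> i) \<le> (\<integral>p. c p \<partial>\<gamma>)" if "\<gamma> \<in> couplings \<mu> \<nu>" for i \<gamma>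
    using \<Gamma>(1)[of i] that by (force simp: optimal_couplings_def is_arg_min_def)
  have \<Gamma>_ps: "prob_space (\<Gamma> i)" and \<Gamma>_sets: "sets (\<Gamma> i) = sets borel"
    and \<Gamma>_fst: "distr (\<Gamma> i) borel fst = \<mu>" and \<Gamma>_snd: "distr (\<Gamma> i) borel snd = \<nu>" for i
    using coupling_prob_space[OF coup \<mu>(1)] coup[of i] by (auto simp: couplings_def)
  define gain where "gain Z = (\<Sum>i<I. c (fst (Z (Suc i mod I)), snd (Z i)) - c (Z i))"
    for Z :: "nat \<Rightarrow> 'a \<times> 'b"
  show "0 \<le> (\<Sum>i<I. c (x (Suc i mod I), y i) - c (x i, y i))"
  proof (rule ccontr)
    assume "\<not> ?thesis"
    then have neg: "gain (\<lambda>i. (x i, y i)) < 0" by (simp add: gain_def)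
    \<comment> \<open>Continuity in the product topology yields neighbourhoods \<open>X i\<close> on which the gain stays negative.\<close>
    have "continuous_on UNIV gain"
      unfolding gain_def
      by (intro continuous_intros continuous_on_compose2[OF c] continuous_on_product_coordinates) auto
    then have "open {Z. gain Z < 0}" by (intro open_Collect_less continuous_on_const)
    then have "openin (product_topology (\<lambda>i. euclidean) UNIV) {Z. gain Z < 0}"
      by (simp add: open_fun_def)
    from product_topology_open_contains_basis[OF this, of "\<lambda>i. (x i, y i)"] neg
    obtain X where X: "\<And>i. (x i, y i) \<in> X i" "\<And>i. open (X i)" "Pi\<^sub>E UNIV X \<subseteq> {Z. gain Z < 0}"
      by (force simp: PiE_iff)
    interpret \<Gamma>: product_prob_space \<Gamma> "{..<I}"
      using \<Gamma>_ps by (auto simp: product_prob_space_def product_sigma_finite_def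
        product_prob_space_axioms_def intro: prob_space_imp_sigma_finite)
    define Q where "Q = Pi\<^sub>M {..<I} \<Gamma>"
    interpret Q: prob_space Q unfolding Q_def by (rule \<Gamma>.P.prob_space_axioms)
    have comp [measurable]: "(\<lambda>Z. Z i) \<in> measurable Q borel" if "i < I" for i
    proof -
      have "(\<lambda>Z. Z i) \<in> measurable Q (\<Gamma> i)" unfolding Q_def using that by (intro measurable_component_singleton) auto
      then show ?thesis by (simp add: \<Gamma>_sets cong: measurable_cong_sets)
    qed
    define E where "E = {Z \<in> space Q. \<forall>i<I. Z i \<in> X i}"
    have E_sets: "E \<in> sets Q"
    proof -
      have "E = (\<Inter>i\<in>{..<I}. (\<lambda>Z. Z i) -` X i \<inter> space Q)"
        using J_ne by (auto simp: E_def)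
      also have "\<dots> \<in> sets Q"
        using I X(2) comp by (intro sets.finite_INT measurable_sets[OF comp]) (auto simp: J_ne)
      finally show ?thesis .
    qed
    have "measure Q E = (\<Prod>i<I. measure (\<Gamma> i) (X i))"
    proof -
      have "emeasure Q E = (\<Prod>i<I. emeasure (\<Gamma> i) (X i))"
        using \<Gamma>.emeasure_PiM_Collect[of "{..<I}" X] X(2) \<Gamma>_sets by (simp add: Q_def E_def Ball_def)
      also have "\<dots> = ennreal (\<Prod>i<I. measure (\<Gamma> i) (X i))"
        by (simp add: prod_ennreal finite_measure.emeasure_eq_measure[OF prob_space.axioms(1)[OF \<Gamma>_ps]] prod_nonneg)
      finally show ?thesis by (simp add: Q.emeasure_eq_measure prod_nonneg)
    qed
    also have "\<dots> > 0"
      using \<Gamma>(2) X by (intro prod_pos) (auto simp: measure_support_def)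
    finally have E_pos: "0 < measure Q E" .
    have gain_E: "gain Z < 0" if "Z \<in> E" for Z
    proof -
      define Z' where "Z' i = (if i < I then Z i else (x i, y i))" for i
      have "Z' \<in> Pi\<^sub>E UNIV X" using that X(1) by (auto simp: Z'_def E_def)
      then have "gain Z' < 0" using X(3) by auto
      moreover have "gain Z' = gain Z" using I by (auto simp: gain_def Z'_def intro!: sum.cong)
      ultimately show ?thesis by simp
    qed
    define W where "W i Z = (if i < I then (if Z \<in> E then (fst (Z (Suc i mod I)), snd (Z i)) else Z i) else Z 0)"
      for i and Z :: "nat \<Rightarrow> 'a \<times> 'b"
    have W_meas: "W i \<in> measurable Q borel" for i
    proof -
      have cross: "(\<lambda>Z. (fst (Z j), snd (Z i))) \<in> measurable Q borel" if "i < I" "j < I" for i j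
        using measurable_compose[OF comp[OF that(1)] measurable_borel_fst_snd(2)]
          measurable_compose[OF comp[OF that(2)] measurable_borel_fst_snd(1)]
        by (intro borel_measurable_Pair)
      show ?thesis
      proof (cases "i < I")
        case True
        then show ?thesis
          unfolding W_def using cross[of i "Suc i mod I"] comp[of i] E_sets I
          by (auto intro!: measurable_If_set)
      next
        case False
        then show ?thesis unfolding W_def using comp[of 0] I by auto
      qed
    qed
    define P where "P = measure_pmf (pmf_of_set {..<I})"
    interpret P: prob_space P unfolding P_def by (rule measure_pmf.prob_space_axioms)
    interpret PQ: pair_prob_space P Q ..
    define \<gamma> where "\<gamma> = distr (P \<Otimes>\<^sub>M Q) borel (\<lambda>(i, Z). W i Z)"
    have W_meas2: "(\<lambda>(i, Z). W i Z) \<in> measurable (P \<Otimes>\<^sub>M Q) borel"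
    proof -
      have "(\<lambda>(i, Z). W i Z) \<in> measurable (count_space UNIV \<Otimes>\<^sub>M Q) borel"
        using W_meas by (intro measurable_pair_measure_countable1) auto
      moreover have "sets (P \<Otimes>\<^sub>M Q) = sets (count_space UNIV \<Otimes>\<^sub>M Q)"
        by (intro sets_pair_measure_cong) (simp_all add: P_def)
      ultimately show ?thesis by (simp cong: measurable_cong_sets)
    qed
    interpret \<gamma>: prob_space \<gamma> unfolding \<gamma>_def by (rule PQ.prob_space_distr[OF W_meas2])
    have bounded: "\<exists>B. \<forall>z. \<bar>g z\<bar> \<le> B" if "continuous_on UNIV g" for g :: "'a \<times> 'b \<Rightarrow> real"
      using compact_imp_bounded[OF compact_continuous_image[OF that cpt_prod]] by (auto simp: bounded_iff)
    have int_Q: "integrable Q (\<lambda>Z. g (V Z))"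
      if g: "continuous_on UNIV g" and V: "V \<in> measurable Q borel" for g :: "'a \<times> 'b \<Rightarrow> real" and V
    proof -
      obtain B where "\<And>z. \<bar>g z\<bar> \<le> B" using bounded[OF g] by blast
      moreover have "(\<lambda>Z. g (V Z)) \<in> borel_measurable Q"
        using measurable_compose[OF V borel_measurable_continuous_onI[OF g]] .
      ultimately show ?thesis by (intro Q.integrable_const_bound[where B = B]) auto
    qed
    have int_\<gamma>: "(\<integral>p. g p \<partial>\<gamma>) = (\<integral>Z. (\<Sum>i<I. g (W i Z)) \<partial>Q) / I"
      if g: "continuous_on UNIV g" for g :: "'a \<times> 'b \<Rightarrow> real"
    proof -
      obtain B where B: "\<And>z. \<bar>g z\<bar> \<le> B" using bounded[OF g] by blast
      have g_meas: "g \<in> borel_measurable borel" using g by (rule borel_measurable_continuous_onI)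
      have "(\<integral>p. g p \<partial>\<gamma>) = (\<integral>q. g (case q of (i, Z) \<Rightarrow> W i Z) \<partial>(P \<Otimes>\<^sub>M Q))"
        unfolding \<gamma>_def by (rule integral_distr[OF W_meas2 g_meas])
      also have "\<dots> = (\<integral>i. (\<integral>Z. g (W i Z) \<partial>Q) \<partial>P)"
      proof -
        have "integrable (P \<Otimes>\<^sub>M Q) (\<lambda>q. g (case q of (i, Z) \<Rightarrow> W i Z))"
          using B measurable_compose[OF W_meas2 g_meas]
          by (intro PQ.integrable_const_bound[where B = B]) auto
        from PQ.integral_fst'[OF this] show ?thesis by simp
      qed
      also have "\<dots> = (\<Sum>i<I. \<integral>Z. g (W i Z) \<partial>Q) / I"
        unfolding P_def using J_ne by (subst integral_pmf_of_set) auto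
      also have "(\<Sum>i<I. \<integral>Z. g (W i Z) \<partial>Q) = (\<integral>Z. (\<Sum>i<I. g (W i Z)) \<partial>Q)"
        using int_Q[OF g W_meas] by (subst Bochner_Integration.integral_sum) auto
      finally show ?thesis .
    qed
    have int_\<Gamma>: "(\<integral>Z. (\<Sum>i<I. g (Z i)) \<partial>Q) = (\<Sum>i<I. \<integral>p. g p \<partial>\<Gamma> i)"
      if g: "continuous_on UNIV g" for g :: "'a \<times> 'b \<Rightarrow> real"
    proof -
      have "(\<integral>Z. (\<Sum>i<I. g (Z i)) \<partial>Q) = (\<Sum>i<I. \<integral>Z. g (Z i) \<partial>Q)"
        using int_Q[OF g comp] by (subst Bochner_Integration.integral_sum) auto
      also have "(\<integral>Z. g (Z i) \<partial>Q) = (\<integral>p. g p \<partial>\<Gamma> i)" if "i < I" for i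
      proof -
        have "g \<in> borel_measurable (\<Gamma> i)"
          by (rule measurable_if_sets_borel[OF \<Gamma>_sets borel_measurable_continuous_onI[OF g]])
        then have "(\<integral>p. g p \<partial>distr Q (\<Gamma> i) (\<lambda>Z. Z i)) = (\<integral>Z. g (Z i) \<partial>Q)"
          unfolding Q_def using that by (intro integral_distr measurable_component_singleton) auto
        moreover have "distr Q (\<Gamma> i) (\<lambda>Z. Z i) = \<Gamma> i"
          unfolding Q_def using that by (intro \<Gamma>.PiM_component) auto
        ultimately show ?thesis by simp
      qed
      then have "(\<Sum>i<I. \<integral>Z. g (Z i) \<partial>Q) = (\<Sum>i<I. \<integral>p. g p \<partial>\<Gamma> i)" by (intro sum.cong) auto
      finally show ?thesis .
    qed
    have mod_less: "Suc i mod I < I" for i using I by simp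
    have fin: "finite_measure \<mu>" "finite_measure \<nu>" using \<mu>(1) \<nu>(1) by (auto simp: prob_space_def)
    have sets_\<gamma>: "sets \<gamma> = sets borel" by (simp add: \<gamma>_def)
    have proj: "fst \<in> borel_measurable \<gamma>" "snd \<in> borel_measurable \<gamma>"
      "fst \<in> borel_measurable (\<Gamma> i)" "snd \<in> borel_measurable (\<Gamma> i)" for i
      by (rule measurable_if_sets_borel[OF sets_\<gamma>] measurable_if_sets_borel[OF \<Gamma>_sets],
          rule measurable_borel_fst_snd)+
    have "distr \<gamma> borel fst = \<mu>"
    proof (rule finite_borel_measure_eqI_continuous[OF cpt(1)])
      show "finite_measure (distr \<gamma> borel fst)" by (rule \<gamma>.finite_measure_distr[OF proj(1)])
      fix f :: "'a \<Rightarrow> real" assume f: "continuous_on UNIV f"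
      have f_meas: "f \<in> borel_measurable borel" using f by (rule borel_measurable_continuous_onI)
      have f': "continuous_on UNIV (\<lambda>p::'a \<times> 'b. f (fst p))"
        by (rule continuous_on_compose2[OF f]) (auto intro: continuous_intros)
      have sum_eq: "(\<Sum>i<I. f (fst (W i Z))) = (\<Sum>i<I. f (fst (Z i)))" for Z
      proof (cases "Z \<in> E")
        case True
        then have "(\<Sum>i<I. f (fst (W i Z))) = (\<Sum>i<I. f (fst (Z (Suc i mod I))))"
          by (intro sum.cong) (auto simp: W_def)
        then show ?thesis by (simp add: sum_Suc_mod[of "\<lambda>i. f (fst (Z i))"])
      qed (auto simp: W_def intro!: sum.cong)
      have \<Gamma>_int: "(\<integral>p. f (fst p) \<partial>\<Gamma> i) = (\<integral>x. f x \<partial>\<mu>)" for i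
        using integral_distr[OF proj(3) f_meas, of i] by (simp add: \<Gamma>_fst)
      have "(\<integral>x. f x \<partial>distr \<gamma> borel fst) = (\<integral>p. f (fst p) \<partial>\<gamma>)"
        by (rule integral_distr[OF proj(1) f_meas])
      also have "\<dots> = (\<integral>x. f x \<partial>\<mu>)"
        using int_\<gamma>[OF f'] int_\<Gamma>[OF f'] I by (simp add: sum_eq \<Gamma>_int)
      finally show "(\<integral>x. f x \<partial>distr \<gamma> borel fst) = (\<integral>x. f x \<partial>\<mu>)" .
    qed (use \<mu> fin in auto)
    moreover have "distr \<gamma> borel snd = \<nu>"
    proof (rule finite_borel_measure_eqI_continuous[OF cpt(2)])
      show "finite_measure (distr \<gamma> borel snd)" by (rule \<gamma>.finite_measure_distr[OF proj(2)])
      fix f :: "'b \<Rightarrow> real" assume f: "continuous_on UNIV f"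
      have f_meas: "f \<in> borel_measurable borel" using f by (rule borel_measurable_continuous_onI)
      have f': "continuous_on UNIV (\<lambda>p::'a \<times> 'b. f (snd p))"
        by (rule continuous_on_compose2[OF f]) (auto intro: continuous_intros)
      have sum_eq: "(\<Sum>i<I. f (snd (W i Z))) = (\<Sum>i<I. f (snd (Z i)))" for Z
        by (intro sum.cong) (auto simp: W_def)
      have \<Gamma>_int: "(\<integral>p. f (snd p) \<partial>\<Gamma> i) = (\<integral>x. f x \<partial>\<nu>)" for i
        using integral_distr[OF proj(4) f_meas, of i] by (simp add: \<Gamma>_snd)
      have "(\<integral>x. f x \<partial>distr \<gamma> borel snd) = (\<integral>p. f (snd p) \<partial>\<gamma>)"
        by (rule integral_distr[OF proj(2) f_meas])
      also have "\<dots> = (\<integral>x. f x \<partial>\<nu>)"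
        using int_\<gamma>[OF f'] int_\<Gamma>[OF f'] I by (simp add: sum_eq \<Gamma>_int)
      finally show "(\<integral>x. f x \<partial>distr \<gamma> borel snd) = (\<integral>x. f x \<partial>\<nu>)" .
    qed (use \<nu> fin in auto)
    ultimately have "\<gamma> \<in> couplings \<mu> \<nu>" using sets_\<gamma> by (simp add: couplings_def)
    have gain_eq: "(\<Sum>i<I. c (W i Z)) = (\<Sum>i<I. c (Z i)) + (if Z \<in> E then gain Z else 0)" for Z
      by (auto simp: W_def gain_def sum_subtractf)
    have "(\<integral>Z. (\<Sum>i<I. c (W i Z)) \<partial>Q) < (\<integral>Z. (\<Sum>i<I. c (Z i)) \<partial>Q)"
    proof (rule Q.integral_less_AE)
      show "integrable Q (\<lambda>Z. \<Sum>i<I. c (W i Z))" "integrable Q (\<lambda>Z. \<Sum>i<I. c (Z i))"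
        using int_Q[OF c W_meas] int_Q[OF c comp] by auto
      show "E \<in> sets Q" by (rule E_sets)
      show "emeasure Q E \<noteq> 0" using E_pos by (simp add: Q.emeasure_eq_measure)
      show "AE Z in Q. Z \<in> E \<longrightarrow> (\<Sum>i<I. c (W i Z)) \<noteq> (\<Sum>i<I. c (Z i))"
        using gain_E by (intro AE_I2) (auto simp: gain_eq dest: order_less_imp_not_eq)
      show "AE Z in Q. (\<Sum>i<I. c (W i Z)) \<le> (\<Sum>i<I. c (Z i))"
        using gain_E by (intro AE_I2) (auto simp: gain_eq less_imp_le)
    qed
    then have "(\<integral>p. c p \<partial>\<gamma>) < (\<Sum>i<I. \<integral>p. c p \<partial>\<Gamma> i) / I"
      using I by (simp add: int_\<gamma>[OF c] int_\<Gamma>[OF c] divide_strict_right_mono)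
    also have "\<dots> \<le> (\<Sum>i<I. \<integral>p. c p \<partial>\<gamma>) / I"
      using opt[OF \<open>\<gamma> \<in> couplings \<mu> \<nu>\<close>] I by (intro divide_right_mono sum_mono) auto
    also have "\<dots> = (\<integral>p. c p \<partial>\<gamma>)" using I by simp
    finally show False by simp
  qed
qed

section \<open>Non-uniqueness of slopes is exceptional\<close>

text \<open>
  The translates of \<open>B\<close> by \<open>e / (n + 1)\<close> are pairwise disjoint, have equal measure and lie in
  a common ball.
\<close>

lemma null_set_if_meets_lines_once:
  fixes B :: "'e::euclidean_space set"
  assumes B: "B \<in> sets borel" "bounded B"
    and e: "e \<noteq> 0"
    and once: "\<And>a s. a \<in> B \<Longrightarrow> a + s *\<^sub>R e \<in> B \<Longrightarrow> s = 0"
  shows "B \<in> null_sets lborel"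
proof -
  define v where "v n = - ((1 / real (Suc n)) *\<^sub>R e)" for n
  define T where "T n = (\<lambda>x. v n + x) -` B" for n
  have T_sets: "T n \<in> sets lborel" for n
    using measurable_sets_borel[of "\<lambda>x. v n + x" borel B] B(1) by (simp add: T_def)
  have T_eq: "emeasure lborel (T n) = emeasure lborel B" for n
  proof -
    have "emeasure lborel B = emeasure (distr lborel borel ((+) (v n))) B" by (simp add: lborel_distr_plus)
    also have "\<dots> = emeasure lborel (T n)" using B(1) by (subst emeasure_distr) (auto simp: T_def)
    finally show ?thesis by simp
  qed
  have disj: "disjoint_family T"
    unfolding disjoint_family_on_def
  proof (intro ballI impI)
    fix m n :: nat assume "m \<noteq> n"
    show "T m \<inter> T n = {}"
    proof (rule ccontr)
      assume "T m \<inter> T n \<noteq> {}"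
      then obtain x where x: "v m + x \<in> B" "v n + x \<in> B" by (auto simp: T_def)
      have "v n + x = (v m + x) + (1 / real (Suc m) - 1 / real (Suc n)) *\<^sub>R e"
        by (simp add: v_def algebra_simps)
      then have "1 / real (Suc m) - 1 / real (Suc n) = 0"
        using once[OF x(1)] x(2) by (metis (no_types, lifting))
      then have "inverse (real (Suc m)) = inverse (real (Suc n))"
        by (simp add: inverse_eq_divide del: of_nat_Suc)
      then show False using \<open>m \<noteq> n\<close> by (simp del: of_nat_Suc)
    qed
  qed
  obtain R where R: "\<And>x. x \<in> B \<Longrightarrow> norm x \<le> R" using B(2) by (auto simp: bounded_iff)
  have sub: "T n \<subseteq> cball 0 (R + norm e)" for n
  proof
    fix x assume "x \<in> T n"
    then have "norm (v n + x) \<le> R" using R by (simp add: T_def)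
    moreover have "norm (v n) \<le> norm e" by (simp add: v_def field_simps)
    ultimately show "x \<in> cball 0 (R + norm e)"
      using norm_triangle_ineq4[of "v n + x" "v n"] by simp
  qed
  have fin: "emeasure lborel B < \<infinity>"
  proof -
    have "emeasure lborel B \<le> emeasure lborel (cball (0::'e) (R + norm e))"
      unfolding T_eq[of 0, symmetric] using sub by (intro emeasure_mono) auto
    then show ?thesis using emeasure_lborel_cball_finite[of "0::'e" "R + norm e"] by simp
  qed
  have bound: "real N * measure lborel B \<le> measure lborel (cball (0::'e) (R + norm e))" for N
  proof -
    have "of_nat N * emeasure lborel B = (\<Sum>n<N. emeasure lborel (T n))" by (simp add: T_eq)
    also have "\<dots> = emeasure lborel (\<Union>n<N. T n)"
      using T_sets disj by (intro sum_emeasure) (auto simp: disjoint_family_on_def)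
    also have "\<dots> \<le> emeasure lborel (cball (0::'e) (R + norm e))"
      using sub by (intro emeasure_mono) auto
    finally have "of_nat N * emeasure lborel B \<le> emeasure lborel (cball (0::'e) (R + norm e))" .
    then show ?thesis
      using emeasure_lborel_cball_finite[of "0::'e" "R + norm e"] fin
      by (simp add: emeasure_eq_ennreal_measure ennreal_of_nat_eq_real_of_nat ennreal_mult[symmetric] less_top[symmetric])
  qed
  have "measure lborel B = 0"
  proof (rule ccontr)
    assume "measure lborel B \<noteq> 0"
    then have "measure lborel B > 0" by (simp add: zero_less_measure_iff)
    then obtain N where "measure lborel (cball (0::'e) (R + norm e)) < real N * measure lborel B"
      using reals_Archimedean3 by blast
    then show False using bound[of N] by simp
  qed
  then show ?thesis
    using fin B(1) by (intro null_setsI) (auto simp: emeasure_eq_ennreal_measure less_top[symmetric])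
qed

text \<open>
  Here \<open>G a y\<close> is the derivative of \<open>F\<close> in its first variable and \<open>mono\<close> is cyclical
  monotonicity of \<open>S\<close> for two-cycles with respect to the cost \<open>F\<close>. If two different slopes occur at \<open>a\<close>, then
  there are a basis vector \<open>v\<close> and rationals \<open>p < q\<close> such that \<open>a\<close> lies in the set \<open>D v p q\<close>
  of points with one slope at most \<open>p\<close> and another one at least \<open>q\<close> in
  direction \<open>v\<close>. On a ball where all slopes oscillate by less than \<open>(q - p) / 3\<close>, this set
  meets each line in direction \<open>v\<close> at most once.
\<close>

lemma slope_nonunique_negligible:
  fixes F :: "'e::euclidean_space \<Rightarrow> 'b::{second_countable_topology, t2_space} \<Rightarrow> real"
    and G :: "'e \<Rightarrow> 'b \<Rightarrow> 'e \<Rightarrow> real"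
  assumes cpt: "compact (UNIV :: 'b set)" and \<Omega>: "open \<Omega>"
    and deriv: "\<And>a y. a \<in> \<Omega> \<Longrightarrow> ((\<lambda>a. F a y) has_derivative G a y) (at a)"
    and cont: "\<And>v. continuous_on (\<Omega> \<times> UNIV) (\<lambda>(a, y). G a y v)"
    and S: "closedin (top_of_set (\<Omega> \<times> UNIV)) S"
    and mono: "\<And>a y b z. (a, y) \<in> S \<Longrightarrow> (b, z) \<in> S \<Longrightarrow> F a y + F b z \<le> F b y + F a z"
  shows "negligible {a. \<exists>y z. (a, y) \<in> S \<and> (a, z) \<in> S \<and> G a y \<noteq> G a z}"
proof -
  obtain T where T: "closed T" "S = (\<Omega> \<times> UNIV) \<inter> T"
    using S by (auto simp: closedin_closed)
  define D where "D v p q = {a. \<exists>y z. (a, y) \<in> S \<and> (a, z) \<in> S \<and> G a y v \<le> p \<and> q \<le> G a z v}"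
    for v p q
  have neg: "negligible (D v p q)" if v: "v \<in> Basis" and pq: "p < q" for v p q
  proof (subst locally_negligible_alt, intro ballI)
    fix a0 assume "a0 \<in> D v p q"
    then have a0: "a0 \<in> \<Omega>" using T by (auto simp: D_def)
    define \<epsilon> where "\<epsilon> = (q - p) / 3"
    have \<epsilon>: "\<epsilon> > 0" using pq by (simp add: \<epsilon>_def)
    define near where "near = (\<Omega> \<times> UNIV) \<inter> (\<lambda>z. \<bar>(case z of (a, y) \<Rightarrow> G a y v) - G a0 (snd z) v\<bar>) -` {..<\<epsilon> / 2}"
    have "continuous_on (\<Omega> \<times> UNIV) (\<lambda>z. \<bar>(case z of (a, y) \<Rightarrow> G a y v) - G a0 (snd z) v\<bar>)"
    proof (intro continuous_on_rabs continuous_on_diff cont)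
      have "continuous_on (\<Omega> \<times> (UNIV :: 'b set)) (\<lambda>z. (a0, snd z))" by (intro continuous_intros)
      from continuous_on_compose2[OF cont[of v] this] a0
      show "continuous_on (\<Omega> \<times> UNIV) (\<lambda>z. G a0 (snd z) v)" by auto
    qed
    then have "open near"
      unfolding near_def by (rule continuous_open_preimage) (auto intro: open_Times \<Omega>)
    moreover have "{a0} \<times> UNIV \<subseteq> near"
      unfolding near_def using a0 \<epsilon> by auto
    ultimately have "\<exists>U. a0 \<in> U \<and> open U \<and> U \<times> UNIV \<subseteq> near"
      by (rule Elementary_Topology.tube_lemma[OF cpt])
    then obtain U where U: "a0 \<in> U" "open U" "U \<times> UNIV \<subseteq> near" by blast
    then obtain r where r: "r > 0" "cball a0 r \<subseteq> U" using open_contains_cball by blast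
    have rU: "a \<in> \<Omega> \<and> \<bar>G a y v - G a0 y v\<bar> < \<epsilon> / 2" if "a \<in> cball a0 r" for a y
    proof -
      have "(a, y) \<in> U \<times> UNIV" using that r by auto
      then have "(a, y) \<in> near" using U(3) by blast
      then show ?thesis by (simp add: near_def)
    qed
    have osc: "\<bar>G a y v - G b y v\<bar> < \<epsilon>" if "a \<in> cball a0 r" "b \<in> cball a0 r" for a b y
      using rU[OF that(1), of y] rU[OF that(2), of y] by linarith
    have sub: "cball a0 r \<subseteq> \<Omega>" using rU by blast
    have cpt_box: "compact (cball a0 r \<times> (UNIV :: 'b set))" by (intro compact_Times cpt compact_cball)
    have cont': "continuous_on (cball a0 r \<times> UNIV) (\<lambda>(a, y). G a y v)"
      using sub by (intro continuous_on_subset[OF cont]) auto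
    define lower where "lower = T \<inter> ((cball a0 r \<times> UNIV) \<inter> (\<lambda>(a, y). G a y v) -` {..p})"
    define upper where "upper = T \<inter> ((cball a0 r \<times> UNIV) \<inter> (\<lambda>(a, y). G a y v) -` {q..})"
    have closed: "closed lower" "closed upper"
      unfolding lower_def upper_def
      by (intro closed_Int T(1) continuous_closed_preimage[OF cont'] closed_Times; simp)+
    have "lower = (cball a0 r \<times> UNIV) \<inter> lower" "upper = (cball a0 r \<times> UNIV) \<inter> upper"
      by (auto simp: lower_def upper_def)
    then have "compact lower" "compact upper"
      using compact_Int_closed[OF cpt_box] closed by metis+
    then have cpt_A: "compact (fst ` lower \<inter> fst ` upper)"
      by (intro compact_Int compact_continuous_image continuous_intros)
    have A: "a \<in> fst ` lower \<inter> fst ` upper \<longleftrightarrow> a \<in> cball a0 r \<and> a \<in> D v p q" for a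
      unfolding D_def lower_def upper_def T(2) using sub by (force simp: image_iff)
    have key: False
      if a: "a \<in> cball a0 r" "a \<in> D v p q"
        and b: "a + s *\<^sub>R v \<in> cball a0 r" "a + s *\<^sub>R v \<in> D v p q" and "0 < s" for a s
    proof -
      obtain y where y: "(a, y) \<in> S" "G a y v \<le> p" using a(2) by (auto simp: D_def)
      obtain z where z: "(a + s *\<^sub>R v, z) \<in> S" "q \<le> G (a + s *\<^sub>R v) z v" using b(2) by (auto simp: D_def)
      have seg: "a + t *\<^sub>R v \<in> cball a0 r" if "0 \<le> t" "t \<le> s" for t
      proof -
        have "a + t *\<^sub>R v = (1 - t / s) *\<^sub>R a + (t / s) *\<^sub>R (a + s *\<^sub>R v)"
          using \<open>0 < s\<close> by (simp add: algebra_simps)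
        also have "\<dots> \<in> cball a0 r"
          using convexD_alt[OF convex_cball \<open>a \<in> cball a0 r\<close> \<open>a + s *\<^sub>R v \<in> cball a0 r\<close>, of "t / s"] that \<open>0 < s\<close>
          by simp
        finally show ?thesis .
      qed
      have mvt: "\<exists>t>0. t < s \<and> F (a + s *\<^sub>R v) w - F a w = s * G (a + t *\<^sub>R v) w v" for w
      proof -
        have "((\<lambda>t. F (a + t *\<^sub>R v) w) has_real_derivative G (a + t *\<^sub>R v) w v) (at t)"
          if "0 \<le> t" "t \<le> s" for t
        proof -
          have "a + t *\<^sub>R v \<in> \<Omega>" using seg[OF that] sub by auto
          then have dF: "((\<lambda>a. F a w) has_derivative G (a + t *\<^sub>R v) w) (at (a + t *\<^sub>R v))" by (rule deriv)
          have "((\<lambda>t. a + t *\<^sub>R v) has_derivative (\<lambda>h. h *\<^sub>R v)) (at t)" by (auto intro!: derivative_eq_intros)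
          from has_derivative_compose[OF this dF]
          have "((\<lambda>t. F (a + t *\<^sub>R v) w) has_derivative (\<lambda>h. G (a + t *\<^sub>R v) w (h *\<^sub>R v))) (at t)" .
          moreover have "G (a + t *\<^sub>R v) w (h *\<^sub>R v) = G (a + t *\<^sub>R v) w v * h" for h
            using linear_scale[OF has_derivative_linear[OF dF], of h v] by (simp add: mult.commute)
          ultimately show ?thesis by (simp add: has_field_derivative_def)
        qed
        from MVT2[OF \<open>0 < s\<close> this] show ?thesis by auto
      qed
      obtain t1 where t1: "0 < t1" "t1 < s" "F (a + s *\<^sub>R v) z - F a z = s * G (a + t1 *\<^sub>R v) z v"
        using mvt by blast
      obtain t2 where t2: "0 < t2" "t2 < s" "F (a + s *\<^sub>R v) y - F a y = s * G (a + t2 *\<^sub>R v) y v"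
        using mvt by blast
      have "G (a + t1 *\<^sub>R v) z v > q - \<epsilon>"
        using osc[OF seg[of t1] b(1), of z] t1 z(2) by linarith
      moreover have "G (a + t2 *\<^sub>R v) y v < p + \<epsilon>"
        using osc[OF seg[of t2] a(1), of y] t2 y(2) by linarith
      moreover have "q - \<epsilon> > p + \<epsilon>" using pq by (simp add: \<epsilon>_def field_simps)
      ultimately have "s * G (a + t2 *\<^sub>R v) y v < s * G (a + t1 *\<^sub>R v) z v"
        using \<open>0 < s\<close> by (intro mult_strict_left_mono) linarith+
      then show False using mono[OF y(1) z(1)] t1(3) t2(3) by linarith
    qed
    have "fst ` lower \<inter> fst ` upper \<in> null_sets lborel"
    proof (rule null_set_if_meets_lines_once)
      show "fst ` lower \<inter> fst ` upper \<in> sets borel" using cpt_A by (intro borel_compact)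
      show "bounded (fst ` lower \<inter> fst ` upper)" using cpt_A by (rule compact_imp_bounded)
      show "v \<noteq> 0" using v by auto
      fix a s assume as: "a \<in> fst ` lower \<inter> fst ` upper" "a + s *\<^sub>R v \<in> fst ` lower \<inter> fst ` upper"
      have "\<not> 0 < s" using key[of a s] as unfolding A by blast
      moreover have "\<not> 0 < - s" using key[of "a + s *\<^sub>R v" "- s"] as unfolding A by auto
      ultimately show "s = 0" by simp
    qed
    then have "negligible (fst ` lower \<inter> fst ` upper)"
      unfolding negligible_iff_null_sets by (rule null_sets_completionI)
    then have "negligible (D v p q \<inter> ball a0 r)"
      by (rule negligible_subset) (use A in force)
    then show "\<exists>U. openin (top_of_set (D v p q)) U \<and> a0 \<in> U \<and> negligible U"
      using \<open>a0 \<in> D v p q\<close> r(1) by (intro exI[of _ "D v p q \<inter> ball a0 r"]) auto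
  qed
  define I where "I = {(v, p, q). v \<in> (Basis :: 'e set) \<and> p \<in> \<rat> \<and> q \<in> \<rat> \<and> p < (q::real)}"
  have "countable I"
  proof (rule countable_subset)
    show "I \<subseteq> (Basis :: 'e set) \<times> \<rat> \<times> \<rat>" by (auto simp: I_def)
    show "countable ((Basis :: 'e set) \<times> (\<rat> :: real set) \<times> (\<rat> :: real set))"
      by (intro countable_SIGMA countable_rat countable_finite finite_Basis)
  qed
  then have "negligible (\<Union>((\<lambda>(v, p, q). D v p q) ` I))"
    using neg by (intro negligible_countable_Union) (auto simp: I_def)
  then show ?thesis
  proof (rule negligible_subset)
    show "{a. \<exists>y z. (a, y) \<in> S \<and> (a, z) \<in> S \<and> G a y \<noteq> G a z} \<subseteq> (\<Union>((\<lambda>(v, p, q). D v p q) ` I))"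
    proof
      fix a assume "a \<in> {a. \<exists>y z. (a, y) \<in> S \<and> (a, z) \<in> S \<and> G a y \<noteq> G a z}"
      then obtain y z where yz: "(a, y) \<in> S" "(a, z) \<in> S" "G a y \<noteq> G a z" by auto
      have "a \<in> \<Omega>" using yz(1) T by auto
      then have "linear (G a y)" "linear (G a z)" using deriv has_derivative_linear by blast+
      then obtain v where v: "v \<in> Basis" "G a y v \<noteq> G a z v"
        using linear_eq_stdbasis yz(3) by blast
      have "\<exists>(v, p, q)\<in>I. a \<in> D v p q"
      proof (cases "G a y v < G a z v")
        case True
        then obtain p where p: "p \<in> \<rat>" "G a y v < p" "p < G a z v" using Rats_dense_in_real by blast
        then obtain q where q: "q \<in> \<rat>" "p < q" "q < G a z v" using Rats_dense_in_real by blast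
        have "G a y v \<le> p" "q \<le> G a z v" using p q by auto
        then have "a \<in> D v p q" unfolding D_def using yz by blast
        then show ?thesis using v p q by (auto simp: I_def)
      next
        case False
        then have "G a z v < G a y v" using v by simp
        then obtain p where p: "p \<in> \<rat>" "G a z v < p" "p < G a y v" using Rats_dense_in_real by blast
        then obtain q where q: "q \<in> \<rat>" "p < q" "q < G a y v" using Rats_dense_in_real by blast
        have "G a z v \<le> p" "q \<le> G a y v" using p q by auto
        then have "a \<in> D v p q" unfolding D_def using yz by blast
        then show ?thesis using v p q by (auto simp: I_def)
      qed
      then show "a \<in> (\<Union>((\<lambda>(v, p, q). D v p q) ` I))" by auto
    qed
  qed
qed

section \<open>Partial differentials of the cost on manifolds\<close>

lemma is_chartD:
  assumes "is_chart (U, \<phi>)"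
  shows "open U" "open (\<phi> ` U)" "inj_on \<phi> U" "continuous_on U \<phi>"
    "continuous_on (\<phi> ` U) (inv_into U \<phi>)" "\<And>x. x \<in> U \<Longrightarrow> inv_into U \<phi> (\<phi> x) = x"
proof -
  have h: "homeomorphism U (\<phi> ` U) \<phi> (inv_into U \<phi>)" and o: "open U" "open (\<phi> ` U)"
    using assms by (auto simp: is_chart_def)
  show "open U" "open (\<phi> ` U)" by fact+
  show inv: "inv_into U \<phi> (\<phi> x) = x" if "x \<in> U" for x
    using h that by (simp add: homeomorphism_def)
  show "inj_on \<phi> U" by (rule inj_on_inverseI) (rule inv)
  show "continuous_on U \<phi>" "continuous_on (\<phi> ` U) (inv_into U \<phi>)"
    using h by (simp_all add: homeomorphism_def)
qed

lemma inv_into_map_prod: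
  assumes "is_chart (U, \<phi>)" "is_chart (V, \<psi>)" "a \<in> \<phi> ` U" "b \<in> \<psi> ` V"
  shows "inv_into (U \<times> V) (map_prod \<phi> \<psi>) (a, b) = (inv_into U \<phi> a, inv_into V \<psi> b)"
proof (rule inv_into_f_eq)
  show "inj_on (map_prod \<phi> \<psi>) (U \<times> V)"
    using is_chartD(3)[OF assms(1)] is_chartD(3)[OF assms(2)] by (rule map_prod_inj_on)
qed (use assms(3,4) in \<open>auto simp: is_chartD(6)[OF assms(1)] is_chartD(6)[OF assms(2)]\<close>)

lemma Ck_function_1_prod_chartD:
  assumes \<A>: "smooth_atlas \<A>" and \<B>: "smooth_atlas \<B>"
    and c: "Ck_function 1 (prod_atlas \<A> \<B>) c"
    and U: "(U, \<phi>) \<in> \<A>" and V: "(V, \<psi>) \<in> \<B>"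
  defines "g \<equiv> \<lambda>(a, b). c (inv_into U \<phi> a, inv_into V \<psi> b)"
  shows "\<And>a b. a \<in> \<phi> ` U \<Longrightarrow> b \<in> \<psi> ` V \<Longrightarrow> (g has_derivative frechet_derivative g (at (a, b))) (at (a, b))"
    and "\<And>w. continuous_on (\<phi> ` U \<times> \<psi> ` V) (\<lambda>p. frechet_derivative g (at p) w)"
proof -
  have ch: "is_chart (U, \<phi>)" "is_chart (V, \<psi>)" using \<A> \<B> U V by (auto simp: smooth_atlas_def)
  define g' where "g' = c \<circ> inv_into (U \<times> V) (map_prod \<phi> \<psi>)"
  have im: "map_prod \<phi> \<psi> ` (U \<times> V) = \<phi> ` U \<times> \<psi> ` V" by auto
  have "(U \<times> V, map_prod \<phi> \<psi>) \<in> prod_atlas \<A> \<B>"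
    using U V by (force simp: prod_atlas_def)
  then have g': "\<forall>p\<in>\<phi> ` U \<times> \<psi> ` V. g' differentiable (at p)"
      "\<forall>w. continuous_on (\<phi> ` U \<times> \<psi> ` V) (\<lambda>p. frechet_derivative g' (at p) w)"
    using c unfolding Ck_function_def g'_def im[symmetric] by (auto simp del: map_prod_surj_on)
  have op: "open (\<phi> ` U \<times> \<psi> ` V)" using is_chartD(2)[OF ch(1)] is_chartD(2)[OF ch(2)] by (rule open_Times)
  have eq: "g' p = g p" if "p \<in> \<phi> ` U \<times> \<psi> ` V" for p
    using that inv_into_map_prod[OF ch] by (auto simp: g'_def g_def)
  have der: "(g has_derivative frechet_derivative g' (at p)) (at p)" if "p \<in> \<phi> ` U \<times> \<psi> ` V" for p
  proof (rule has_derivative_transform_within_open[OF _ op that eq])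
    show "(g' has_derivative frechet_derivative g' (at p)) (at p)"
      using bspec[OF g'(1) that] unfolding frechet_derivative_works .
  qed
  then have fd: "frechet_derivative g (at p) = frechet_derivative g' (at p)" if "p \<in> \<phi> ` U \<times> \<psi> ` V" for p
    using that frechet_derivative_at by metis
  show "(g has_derivative frechet_derivative g (at (a, b))) (at (a, b))" if "a \<in> \<phi> ` U" "b \<in> \<psi> ` V" for a b
    using der fd that by auto
  show "continuous_on (\<phi> ` U \<times> \<psi> ` V) (\<lambda>p. frechet_derivative g (at p) w)" for w
  proof -
    have "continuous_on (\<phi> ` U \<times> \<psi> ` V) (\<lambda>p. frechet_derivative g' (at p) w)" using g'(2) by blast
    then show ?thesis by (rule continuous_on_eq) (simp only: fd)
  qed
qed

text \<open>
  The part of the \<open>C\<^sup>1\<close> hypothesis that is needed on one factor, in a form that does not refer to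
  charts of the other factor.
\<close>

definition C1_in_first_variable ::
  "('a::topological_space, 'e::euclidean_space) chart set \<Rightarrow> ('a \<times> 'b::topological_space \<Rightarrow> real) \<Rightarrow> bool" where
  "C1_in_first_variable \<A> c \<longleftrightarrow> (\<forall>(U, \<phi>)\<in>\<A>.
     (\<forall>a\<in>\<phi> ` U. \<forall>y. (\<lambda>a. c (inv_into U \<phi> a, y)) differentiable (at a)) \<and>
     (\<forall>v. continuous_on (\<phi> ` U \<times> UNIV)
            (\<lambda>(a, y). frechet_derivative (\<lambda>a. c (inv_into U \<phi> a, y)) (at a) v)))"

lemma C1_in_first_variableI:
  fixes \<A> :: "('a::topological_space, 'e::euclidean_space) chart set"
    and \<B> :: "('b::topological_space, 'f::euclidean_space) chart set"
  assumes \<A>: "smooth_atlas \<A>" and \<B>: "smooth_atlas \<B>"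
    and der: "\<And>U \<phi> V \<psi> a y. (U, \<phi>) \<in> \<A> \<Longrightarrow> (V, \<psi>) \<in> \<B> \<Longrightarrow> a \<in> \<phi> ` U \<Longrightarrow> y \<in> V \<Longrightarrow>
      ((\<lambda>a. c (inv_into U \<phi> a, y)) has_derivative G U \<phi> V \<psi> a (\<psi> y)) (at a)"
    and cont: "\<And>U \<phi> V \<psi> v. (U, \<phi>) \<in> \<A> \<Longrightarrow> (V, \<psi>) \<in> \<B> \<Longrightarrow>
      continuous_on (\<phi> ` U \<times> \<psi> ` V) (\<lambda>(a, b). G U \<phi> V \<psi> a b v)"
  shows "C1_in_first_variable \<A> c"
  unfolding C1_in_first_variable_def
proof (safe)
  fix U \<phi> assume U: "(U, \<phi>) \<in> \<A>"
  have chU: "is_chart (U, \<phi>)" using \<A> U by (auto simp: smooth_atlas_def)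
  have cover: "(\<Union>C\<in>\<B>. fst C) = UNIV" using \<B> by (simp add: smooth_atlas_def)
  {
    fix x y assume "x \<in> U"
    obtain V \<psi> where V: "(V, \<psi>) \<in> \<B>" "y \<in> V" using cover by fastforce
    have "\<phi> x \<in> \<phi> ` U" using \<open>x \<in> U\<close> by simp
    from der[OF U V(1) this V(2)]
    show "(\<lambda>a. c (inv_into U \<phi> a, y)) differentiable (at (\<phi> x))" by (auto simp: differentiable_def)
  }
  fix v
  have "continuous_on (\<Union>C\<in>\<B>. \<phi> ` U \<times> fst C) (\<lambda>(a, y). frechet_derivative (\<lambda>a. c (inv_into U \<phi> a, y)) (at a) v)"
  proof (rule continuous_on_open_UN)
    fix C assume C: "C \<in> \<B>"
    obtain V \<psi> where [simp]: "C = (V, \<psi>)" by (cases C)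
    have V: "(V, \<psi>) \<in> \<B>" using C by simp
    have chV: "is_chart (V, \<psi>)" using \<B> V by (auto simp: smooth_atlas_def)
    show "open (\<phi> ` U \<times> fst C)" using is_chartD(2)[OF chU] is_chartD(1)[OF chV] by (auto intro: open_Times)
    have "continuous_on (\<phi> ` U \<times> V) (\<lambda>(a, y). (a, \<psi> y))"
      unfolding case_prod_beta
      by (intro continuous_intros continuous_on_compose2[OF is_chartD(4)[OF chV]]) auto
    from continuous_on_compose2[OF cont[OF U V, of v] this]
    have "continuous_on (\<phi> ` U \<times> V) (\<lambda>(a, y). G U \<phi> V \<psi> a (\<psi> y) v)"
      by (fastforce simp: case_prod_beta)
    moreover have "frechet_derivative (\<lambda>a. c (inv_into U \<phi> a, y)) (at a) = G U \<phi> V \<psi> a (\<psi> y)"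
      if "a \<in> \<phi> ` U" "y \<in> V" for a y
      using frechet_derivative_at[OF der[OF U V that]] by simp
    ultimately show "continuous_on (\<phi> ` U \<times> fst C) (\<lambda>(a, y). frechet_derivative (\<lambda>a. c (inv_into U \<phi> a, y)) (at a) v)"
      by (subst continuous_on_cong[OF refl]) auto
  qed
  moreover have "(\<Union>C\<in>\<B>. \<phi> ` U \<times> fst C) = \<phi> ` U \<times> UNIV" using cover by blast
  ultimately show "continuous_on (\<phi> ` U \<times> UNIV) (\<lambda>(a, y). frechet_derivative (\<lambda>a. c (inv_into U \<phi> a, y)) (at a) v)"
    by simp
qed

lemma Ck_function_1_imp_C1_in_variables:
  fixes \<A> :: "('a::topological_space, 'e::euclidean_space) chart set"
    and \<B> :: "('b::topological_space, 'f::euclidean_space) chart set"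
  assumes \<A>: "smooth_atlas \<A>" and \<B>: "smooth_atlas \<B>"
    and c: "Ck_function 1 (prod_atlas \<A> \<B>) c"
  shows "C1_in_first_variable \<A> c" "C1_in_first_variable \<B> (\<lambda>(y, x). c (x, y))"
proof -
  define g where "g U \<phi> V \<psi> = (\<lambda>(a, b). c (inv_into U \<phi> a, inv_into V \<psi> b))"
    for U :: "'a set" and \<phi> :: "'a \<Rightarrow> 'e" and V :: "'b set" and \<psi> :: "'b \<Rightarrow> 'f"
  note g = Ck_function_1_prod_chartD[OF \<A> \<B> c, folded g_def]
  have ch: "(U, \<phi>) \<in> \<A> \<Longrightarrow> is_chart (U, \<phi>)" "(V, \<psi>) \<in> \<B> \<Longrightarrow> is_chart (V, \<psi>)" for U \<phi> V \<psi>
    using \<A> \<B> by (auto simp: smooth_atlas_def)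
  show "C1_in_first_variable \<A> c"
  proof (rule C1_in_first_variableI[OF \<A> \<B>,
        where G = "\<lambda>U \<phi> V \<psi> a b v. frechet_derivative (g U \<phi> V \<psi>) (at (a, b)) (v, 0)"])
    fix U \<phi> V \<psi> a y assume U: "(U, \<phi>) \<in> \<A>" and V: "(V, \<psi>) \<in> \<B>" and ay: "a \<in> \<phi> ` U" "y \<in> V"
    have "((\<lambda>a. (a, \<psi> y)) has_derivative (\<lambda>h. (h, 0))) (at a)" by (auto intro!: derivative_eq_intros)
    from has_derivative_compose[OF this g(1)[OF U V ay(1)]] ay(2)
    have "((\<lambda>a. g U \<phi> V \<psi> (a, \<psi> y)) has_derivative
        (\<lambda>h. frechet_derivative (g U \<phi> V \<psi>) (at (a, \<psi> y)) (h, 0))) (at a)" by auto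
    then show "((\<lambda>a. c (inv_into U \<phi> a, y)) has_derivative
        (\<lambda>h. frechet_derivative (g U \<phi> V \<psi>) (at (a, \<psi> y)) (h, 0))) (at a)"
      using is_chartD(6)[OF ch(2)[OF V] ay(2)] by (simp add: g_def)
  next
    fix U \<phi> V \<psi> v assume U: "(U, \<phi>) \<in> \<A>" and V: "(V, \<psi>) \<in> \<B>"
    show "continuous_on (\<phi> ` U \<times> \<psi> ` V) (\<lambda>(a, b). frechet_derivative (g U \<phi> V \<psi>) (at (a, b)) (v, 0))"
      using g(2)[OF U V] by (simp add: case_prod_beta)
  qed
  show "C1_in_first_variable \<B> (\<lambda>(y, x). c (x, y))"
  proof (rule C1_in_first_variableI[OF \<B> \<A>,
        where G = "\<lambda>V \<psi> U \<phi> b a v. frechet_derivative (g U \<phi> V \<psi>) (at (a, b)) (0, v)"])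
    fix U \<phi> V \<psi> b x assume V: "(V, \<psi>) \<in> \<B>" and U: "(U, \<phi>) \<in> \<A>" and bx: "b \<in> \<psi> ` V" "x \<in> U"
    have "((\<lambda>b. (\<phi> x, b)) has_derivative (\<lambda>h. (0, h))) (at b)" by (auto intro!: derivative_eq_intros)
    from has_derivative_compose[OF this g(1)[OF U V _ bx(1)]] bx(2)
    have "((\<lambda>b. g U \<phi> V \<psi> (\<phi> x, b)) has_derivative
        (\<lambda>h. frechet_derivative (g U \<phi> V \<psi>) (at (\<phi> x, b)) (0, h))) (at b)" by auto
    then show "((\<lambda>b. (\<lambda>(y, x). c (x, y)) (inv_into V \<psi> b, x)) has_derivative
        (\<lambda>h. frechet_derivative (g U \<phi> V \<psi>) (at (\<phi> x, b)) (0, h))) (at b)"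
      using is_chartD(6)[OF ch(1)[OF U] bx(2)] by (simp add: g_def)
  next
    fix U \<phi> V \<psi> v assume V: "(V, \<psi>) \<in> \<B>" and U: "(U, \<phi>) \<in> \<A>"
    have "continuous_on (\<psi> ` V \<times> \<phi> ` U) (\<lambda>p. (snd p, fst p))" by (intro continuous_intros)
    from continuous_on_compose2[OF g(2)[OF U V, of "(0, v)"] this]
    show "continuous_on (\<psi> ` V \<times> \<phi> ` U) (\<lambda>(b, a). frechet_derivative (g U \<phi> V \<psi>) (at (a, b)) (0, v))"
      by (fastforce simp: case_prod_beta)
  qed
qed

lemma Ck_function_1_imp_continuous:
  fixes \<A> :: "('a::topological_space, 'e::euclidean_space) chart set"
    and \<B> :: "('b::topological_space, 'f::euclidean_space) chart set"
  assumes \<A>: "smooth_atlas \<A>" and \<B>: "smooth_atlas \<B>"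
    and c: "Ck_function 1 (prod_atlas \<A> \<B>) c"
  shows "continuous_on UNIV c"
proof -
  have "continuous_on (\<Union>C\<in>\<A> \<times> \<B>. fst (fst C) \<times> fst (snd C)) c"
  proof (rule continuous_on_open_UN)
    fix C assume "C \<in> \<A> \<times> \<B>"
    then obtain U \<phi> V \<psi> where C: "C = ((U, \<phi>), (V, \<psi>))" and U: "(U, \<phi>) \<in> \<A>" and V: "(V, \<psi>) \<in> \<B>"
      by (cases C) auto
    have ch: "is_chart (U, \<phi>)" "is_chart (V, \<psi>)" using \<A> \<B> U V by (auto simp: smooth_atlas_def)
    show "open (fst (fst C) \<times> fst (snd C))"
      using is_chartD(1)[OF ch(1)] is_chartD(1)[OF ch(2)] by (auto simp: C intro: open_Times)
    define g where "g = (\<lambda>(a, b). c (inv_into U \<phi> a, inv_into V \<psi> b))"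
    have "continuous_on (\<phi> ` U \<times> \<psi> ` V) g"
      using Ck_function_1_prod_chartD(1)[OF \<A> \<B> c U V] unfolding g_def[symmetric]
      by (intro continuous_at_imp_continuous_on) (auto intro: has_derivative_continuous)
    moreover have "continuous_on (U \<times> V) (\<lambda>p. (\<phi> (fst p), \<psi> (snd p)))"
      by (intro continuous_intros continuous_on_compose2[OF is_chartD(4)[OF ch(1)]]
        continuous_on_compose2[OF is_chartD(4)[OF ch(2)]]) auto
    ultimately have "continuous_on (U \<times> V) (\<lambda>p. g (\<phi> (fst p), \<psi> (snd p)))"
      by (rule continuous_on_compose2) auto
    moreover have "g (\<phi> (fst p), \<psi> (snd p)) = c p" if "p \<in> U \<times> V" for p
      using that is_chartD(6)[OF ch(1)] is_chartD(6)[OF ch(2)] by (auto simp: g_def)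
    ultimately show "continuous_on (fst (fst C) \<times> fst (snd C)) c"
      by (subst continuous_on_cong[OF refl, where g = "\<lambda>p. g (\<phi> (fst p), \<psi> (snd p))"]) (auto simp: C)
  qed
  moreover have "(\<Union>C\<in>\<A> \<times> \<B>. fst (fst C) \<times> fst (snd C)) = (\<Union>C\<in>\<A>. fst C) \<times> (\<Union>C\<in>\<B>. fst C)" by force
  ultimately show ?thesis using \<A> \<B> by (simp add: smooth_atlas_def)
qed

text \<open>
  By the chain rule a coordinate expression of the differential in one chart determines those in all the
  others. So it is enough to compare differentials in countably many charts that cover the manifold.
\<close>

lemma differential_eq_if_eq_in_chart:
  fixes \<A> :: "('a::topological_space, 'e::euclidean_space) chart set"
  assumes \<A>: "smooth_atlas \<A>" and U: "(U, \<phi>) \<in> \<A>" and x: "x \<in> U"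
    and f: "(f \<circ> inv_into U \<phi>) differentiable (at (\<phi> x))"
    and f': "(f' \<circ> inv_into U \<phi>) differentiable (at (\<phi> x))"
    and eq: "frechet_derivative (f \<circ> inv_into U \<phi>) (at (\<phi> x)) = frechet_derivative (f' \<circ> inv_into U \<phi>) (at (\<phi> x))"
  shows "differential \<A> f x = differential \<A> f' x"
proof (rule ext)
  fix C :: "('a, 'e) chart"
  obtain V \<psi> where C: "C = (V, \<psi>)" by (cases C)
  show "differential \<A> f x C = differential \<A> f' x C"
  proof (cases "(V, \<psi>) \<in> \<A> \<and> x \<in> V")
    case True
    then have V: "(V, \<psi>) \<in> \<A>" and xV: "x \<in> V" by auto
    have ch: "is_chart (U, \<phi>)" "is_chart (V, \<psi>)" using \<A> U V by (auto simp: smooth_atlas_def)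
    define \<tau> where "\<tau> = \<phi> \<circ> inv_into V \<psi>"
    have "smooth_on (\<psi> ` (V \<inter> U)) \<tau>"
      using \<A> U V unfolding smooth_atlas_def \<tau>_def by fast
    then have "Ck_on (Suc 0) (\<psi> ` (V \<inter> U)) \<tau>" by (simp only: smooth_on_def)
    then have "\<tau> differentiable (at (\<psi> x))" using x xV by simp
    then have \<tau>: "(\<tau> has_derivative frechet_derivative \<tau> (at (\<psi> x))) (at (\<psi> x))"
      by (simp add: frechet_derivative_works)
    have \<tau>x: "\<tau> (\<psi> x) = \<phi> x" using is_chartD(6)[OF ch(2) xV] by (simp add: \<tau>_def)
    have op: "open (\<psi> ` V \<inter> inv_into V \<psi> -` U)"
      by (intro continuous_open_preimage is_chartD(5)[OF ch(2)] is_chartD(2)[OF ch(2)] is_chartD(1)[OF ch(1)])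
    have mem: "\<psi> x \<in> \<psi> ` V \<inter> inv_into V \<psi> -` U"
      using x xV is_chartD(6)[OF ch(2) xV] by auto
    have main: "frechet_derivative (h \<circ> inv_into V \<psi>) (at (\<psi> x)) =
        (\<lambda>v. frechet_derivative (h \<circ> inv_into U \<phi>) (at (\<phi> x)) (frechet_derivative \<tau> (at (\<psi> x)) v))"
      if h: "(h \<circ> inv_into U \<phi>) differentiable (at (\<phi> x))" for h :: "'a \<Rightarrow> real"
    proof -
      have "((h \<circ> inv_into U \<phi>) has_derivative frechet_derivative (h \<circ> inv_into U \<phi>) (at (\<phi> x))) (at (\<tau> (\<psi> x)))"
        using h by (simp add: frechet_derivative_works \<tau>x)
      from has_derivative_compose[OF \<tau> this]
      have "((\<lambda>a. (h \<circ> inv_into U \<phi>) (\<tau> a)) has_derivative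
        (\<lambda>v. frechet_derivative (h \<circ> inv_into U \<phi>) (at (\<phi> x)) (frechet_derivative \<tau> (at (\<psi> x)) v))) (at (\<psi> x))" .
      then have "((h \<circ> inv_into V \<psi>) has_derivative
        (\<lambda>v. frechet_derivative (h \<circ> inv_into U \<phi>) (at (\<phi> x)) (frechet_derivative \<tau> (at (\<psi> x)) v))) (at (\<psi> x))"
        by (rule has_derivative_transform_within_open[OF _ op mem])
          (use is_chartD(6)[OF ch(1)] in \<open>auto simp: \<tau>_def\<close>)
      then show ?thesis using frechet_derivative_at by metis
    qed
    show ?thesis
      using main[OF f] main[OF f'] eq by (simp add: differential_def C)
  qed (auto simp: differential_def C)
qed

text \<open>
  In each of countably many charts covering the manifold this is
  \<open>slope_nonunique_negligible\<close> for the coordinate expression of \<open>c\<close>; absolute continuity transports the null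
  set back.
\<close>

lemma partial_x_nonunique_negligible:
  fixes \<A> :: "('a::{second_countable_topology, t2_space}, 'e::euclidean_space) chart set"
    and c :: "'a \<times> 'b::{second_countable_topology, t2_space} \<Rightarrow> real"
  assumes \<A>: "smooth_atlas \<A>" and cpt: "compact (UNIV :: 'b set)"
    and c: "C1_in_first_variable \<A> c"
    and \<mu>: "sets \<mu> = sets borel" "abs_continuous_in_charts \<A> \<mu>"
    and S: "closed S"
    and mono: "\<And>x y x' y'. (x, y) \<in> S \<Longrightarrow> (x', y') \<in> S \<Longrightarrow> c (x, y) + c (x', y') \<le> c (x', y) + c (x, y')"
  shows "negligible_for \<mu> {x. \<exists>y z. (x, y) \<in> S \<and> (x, z) \<in> S \<and> partial_x \<A> c x y \<noteq> partial_x \<A> c x z}"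
    (is "negligible_for \<mu> ?D")
proof -
  have chart_null: "?D \<inter> U \<in> null_sets (completion \<mu>)" if U: "(U, \<phi>) \<in> \<A>" for U \<phi>
  proof -
    have ch: "is_chart (U, \<phi>)" using \<A> U by (auto simp: smooth_atlas_def)
    note ch = is_chartD[OF ch]
    define F where "F a y = c (inv_into U \<phi> a, y)" for a y
    define G where "G a y = frechet_derivative (\<lambda>a. F a y) (at a)" for a y
    have diff: "(\<lambda>a. F a y) differentiable (at a)" if "a \<in> \<phi> ` U" for a y
      using c U that unfolding C1_in_first_variable_def F_def by fast
    have G_cont: "continuous_on (\<phi> ` U \<times> UNIV) (\<lambda>(a, y). G a y v)" for v
      using c U unfolding C1_in_first_variable_def G_def F_def by fast
    define S' where "S' = (\<phi> ` U \<times> UNIV) \<inter> (\<lambda>p. (inv_into U \<phi> (fst p), snd p)) -` S"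
    have "continuous_on (\<phi> ` U \<times> (UNIV :: 'b set)) (\<lambda>p. (inv_into U \<phi> (fst p), snd p))"
      by (intro continuous_intros continuous_on_compose2[OF ch(5)]) auto
    then have S'_closed: "closedin (top_of_set (\<phi> ` U \<times> UNIV)) S'"
      unfolding S'_def using S by (intro continuous_closedin_preimage)
    have "negligible {a. \<exists>y z. (a, y) \<in> S' \<and> (a, z) \<in> S' \<and> G a y \<noteq> G a z}"
    proof (rule slope_nonunique_negligible[OF cpt ch(2) _ G_cont S'_closed])
      show "((\<lambda>a. F a y) has_derivative G a y) (at a)" if "a \<in> \<phi> ` U" for a y
        using diff[OF that] by (simp add: G_def frechet_derivative_works)
      show "F a y + F b z \<le> F b y + F a z" if "(a, y) \<in> S'" "(b, z) \<in> S'" for a y b z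
        using that mono by (auto simp: F_def S'_def)
    qed
    then obtain N where N: "N \<in> null_sets lborel"
      "{a. \<exists>y z. (a, y) \<in> S' \<and> (a, z) \<in> S' \<and> G a y \<noteq> G a z} \<subseteq> N"
      unfolding negligible_iff_null_sets null_sets_completion_iff2 by blast
    have sub: "?D \<inter> U \<subseteq> U \<inter> \<phi> -` N"
    proof
      fix x assume "x \<in> ?D \<inter> U"
      then obtain y z where x: "x \<in> U" and S: "(x, y) \<in> S" "(x, z) \<in> S"
        and ne: "partial_x \<A> c x y \<noteq> partial_x \<A> c x z" by auto
      have "(\<phi> x, y) \<in> S'" "(\<phi> x, z) \<in> S'" using S x ch(6) by (auto simp: S'_def)
      moreover have "G (\<phi> x) y \<noteq> G (\<phi> x) z"
      proof
        assume eq: "G (\<phi> x) y = G (\<phi> x) z"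
        have comp: "(\<lambda>x'. c (x', w)) \<circ> inv_into U \<phi> = (\<lambda>a. F a w)" for w by (auto simp: F_def)
        have "partial_x \<A> c x y = partial_x \<A> c x z"
          unfolding partial_x_def
          using diff x eq by (intro differential_eq_if_eq_in_chart[OF \<A> U x]) (auto simp: comp G_def)
        then show False using ne by simp
      qed
      ultimately show "x \<in> U \<inter> \<phi> -` N" using N(2) x by blast
    qed
    have U_sets: "U \<in> sets \<mu>" using ch(1) \<mu>(1) by simp
    have \<phi>_meas: "\<phi> \<in> borel_measurable (restrict_space \<mu> U)"
    proof -
      have "\<phi> \<in> borel_measurable (restrict_space borel U)" using ch(4) by (rule borel_measurable_continuous_on_restrict)
      moreover have "sets (restrict_space \<mu> U) = sets (restrict_space borel U)"
        using \<mu>(1) by (rule sets_restrict_space_cong)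
      ultimately show ?thesis by (simp cong: measurable_cong_sets)
    qed
    have "N \<in> null_sets (distr (restrict_space \<mu> U) borel \<phi>)"
      using \<mu>(2) U N(1) unfolding abs_continuous_in_charts_def absolutely_continuous_def by blast
    then have "\<phi> -` N \<inter> space (restrict_space \<mu> U) \<in> null_sets (restrict_space \<mu> U)"
      using \<phi>_meas by (subst (asm) null_sets_distr_iff) auto
    moreover have "\<phi> -` N \<inter> space (restrict_space \<mu> U) = U \<inter> \<phi> -` N"
      using sets_eq_imp_space_eq[OF \<mu>(1)] by (auto simp: space_restrict_space)
    ultimately have "U \<inter> \<phi> -` N \<in> null_sets \<mu>"
      using U_sets by (simp add: null_sets_restrict_space)
    then show ?thesis using sub null_sets_completion_iff2 by blast
  qed
  obtain \<C> where \<C>: "\<C> \<subseteq> fst ` \<A>" "countable \<C>" "\<Union>\<C> = \<Union>(fst ` \<A>)"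
  proof (rule Lindelof)
    show "open U" if U: "U \<in> fst ` \<A>" for U
    proof -
      obtain \<phi> where "(U, \<phi>) \<in> \<A>" using U by auto
      then have "is_chart (U, \<phi>)" using \<A> by (auto simp: smooth_atlas_def)
      then show ?thesis by (rule is_chartD(1))
    qed
  qed (rule that, assumption+)
  have "?D = (\<Union>U\<in>\<C>. ?D \<inter> U)"
  proof -
    have "\<Union>\<C> = UNIV" using \<C>(3) \<A> by (simp add: smooth_atlas_def)
    then show ?thesis by blast
  qed
  also have "\<dots> \<in> null_sets (completion \<mu>)"
  proof (rule null_sets_UN'[OF \<C>(2)])
    fix U assume "U \<in> \<C>"
    then obtain \<phi> where "(U, \<phi>) \<in> \<A>" using \<C>(1) by auto
    then show "?D \<inter> U \<in> null_sets (completion \<mu>)" by (rule chart_null)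
  qed
  finally show ?thesis by (simp add: negligible_for_def)
qed

section \<open>Sigma-compact sets and pruning of bipartite graphs\<close>

lemma sigma_compactI_countable:
  assumes "countable \<K>" "\<And>K. K \<in> \<K> \<Longrightarrow> compact K"
  shows "sigma_compact (\<Union>\<K>)"
proof -
  have "range (from_nat_into (insert {} \<K>)) = insert {} \<K>"
    using assms(1) by (intro range_from_nat_into) auto
  moreover have "compact (from_nat_into (insert {} \<K>) n)" for n
    using assms(2) from_nat_into[of "insert {} \<K>" n] by auto
  ultimately show ?thesis
    unfolding sigma_compact_def by (intro exI[of _ "from_nat_into (insert {} \<K>)"]) auto
qed

lemma sigma_compact_borel:
  fixes T :: "'x::t2_space set"
  assumes "sigma_compact T"
  shows "T \<in> sets borel"
proof -
  obtain K where K: "\<And>n::nat. compact (K n)" "T = (\<Union>n. K n)"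
    using assms unfolding sigma_compact_def by blast
  show ?thesis unfolding K(2) by (intro sets.countable_UN) (auto intro: borel_compact K(1))
qed

lemma sigma_compact_Int:
  fixes T T' :: "'x::t2_space set"
  assumes "sigma_compact T" "sigma_compact T'"
  shows "sigma_compact (T \<inter> T')"
proof -
  obtain K where K: "\<And>n::nat. compact (K n)" "T = (\<Union>n. K n)" using assms(1) unfolding sigma_compact_def by blast
  obtain K' where K': "\<And>n::nat. compact (K' n)" "T' = (\<Union>n. K' n)" using assms(2) unfolding sigma_compact_def by blast
  have "T \<inter> T' = \<Union>((\<lambda>(m, n). K m \<inter> K' n) ` UNIV)" by (auto simp: K K')
  also have "sigma_compact \<dots>"
    by (rule sigma_compactI_countable) (auto intro: compact_Int K K')
  finally show ?thesis .
qed

lemma sigma_compact_Un: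
  assumes "sigma_compact T" "sigma_compact T'"
  shows "sigma_compact (T \<union> T')"
proof -
  obtain K where K: "\<And>n::nat. compact (K n)" "T = (\<Union>n. K n)" using assms(1) unfolding sigma_compact_def by blast
  obtain K' where K': "\<And>n::nat. compact (K' n)" "T' = (\<Union>n. K' n)" using assms(2) unfolding sigma_compact_def by blast
  have "T \<union> T' = \<Union>(range K \<union> range K')" by (auto simp: K K')
  also have "sigma_compact \<dots>"
    by (rule sigma_compactI_countable) (auto intro: K K')
  finally show ?thesis .
qed

lemma sigma_compact_image:
  assumes "sigma_compact T" "continuous_on UNIV f"
  shows "sigma_compact (f ` T)"
proof -
  obtain K where K: "\<And>n::nat. compact (K n)" "T = (\<Union>n. K n)" using assms(1) unfolding sigma_compact_def by blast
  have "f ` T = \<Union>((\<lambda>n. f ` K n) ` UNIV)" by (auto simp: K)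
  also have "sigma_compact \<dots>"
    by (rule sigma_compactI_countable)
      (auto intro!: compact_continuous_image K continuous_on_subset[OF assms(2)])
  finally show ?thesis .
qed

definition x_branching :: "('a \<times> 'b) set \<Rightarrow> ('a \<times> 'b) set" where
  "x_branching T = {(x, y) \<in> T. \<exists>y'. y' \<noteq> y \<and> (x, y') \<in> T}"

definition y_branching :: "('a \<times> 'b) set \<Rightarrow> ('a \<times> 'b) set" where
  "y_branching T = {(x, y) \<in> T. \<exists>x'. x' \<noteq> x \<and> (x', y) \<in> T}"

text \<open>
  The pairs in \<open>T\<close> are edges of a bipartite graph. An edge survives iff both of its end points have
  degree at least two.
\<close>

definition prune :: "('a \<times> 'b) set \<Rightarrow> ('a \<times> 'b) set" where
  "prune T = x_branching T \<inter> y_branching T"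

text \<open>
  The set is a projection of \<open>{(x, y, y'). (x, y) \<in> T \<and> (x, y') \<in> T \<and> y \<noteq> y'}\<close>, which is
  \<open>\<sigma>\<close>-compact because the complement of the diagonal is a countable union of closed sets.
\<close>

lemma sigma_compact_x_branching:
  fixes T :: "('a::{second_countable_topology, t2_space} \<times> 'b::{second_countable_topology, t2_space}) set"
  assumes cpt: "compact (UNIV :: 'a set)" "compact (UNIV :: 'b set)" and T: "sigma_compact T"
  shows "sigma_compact (x_branching T)"
proof -
  obtain K where K: "\<And>n::nat. compact (K n)" "T = (\<Union>n. K n)" using T unfolding sigma_compact_def by blast
  have closedK: "closed (K n)" for n using K(1) by (rule compact_imp_closed)
  have cpt2: "compact (UNIV :: ('b \<times> 'b) set)" using compact_Times[OF cpt(2) cpt(2)] by simp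
  have cpt3: "compact (UNIV :: ('a \<times> 'b \<times> 'b) set)" using compact_Times[OF cpt(1) cpt2] by simp
  have "open {p :: 'b \<times> 'b. fst p \<noteq> snd p}"
    by (intro open_Collect_neq continuous_intros)
  then obtain C where C: "\<And>j::nat. closed (C j)" "{p :: 'b \<times> 'b. fst p \<noteq> snd p} = (\<Union>j. C j)"
    by (rule open_imp_countable_Union_closed[OF cpt2]) (rule that, assumption+)
  define Z where "Z n m j = (\<lambda>q :: 'a \<times> 'b \<times> 'b. (fst q, fst (snd q))) -` K n \<inter>
    (\<lambda>q. (fst q, snd (snd q))) -` K m \<inter> snd -` C j" for n m j
  have cptZ: "compact ((\<lambda>q. (fst q, fst (snd q))) ` Z n m j)" for n m j
  proof (rule compact_continuous_image)
    have "closed (Z n m j)"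
      unfolding Z_def by (intro closed_Int closed_vimage closedK C(1) continuous_intros)
    then show "compact (Z n m j)" by (rule closed_imp_compact_of_compact_UNIV[OF cpt3])
  qed (intro continuous_intros)
  have "x_branching T = \<Union>((\<lambda>(n, m, j). (\<lambda>q. (fst q, fst (snd q))) ` Z n m j) ` UNIV)"
  proof (intro set_eqI iffI)
    fix p assume "p \<in> x_branching T"
    then obtain x y y' where p: "p = (x, y)" "(x, y) \<in> T" "(x, y') \<in> T" "y' \<noteq> y"
      by (auto simp: x_branching_def)
    obtain n m where nm: "(x, y) \<in> K n" "(x, y') \<in> K m" using p K by auto
    have "(y, y') \<in> (\<Union>j. C j)" unfolding C(2)[symmetric] using p(4) by simp
    then obtain j where "(y, y') \<in> C j" by blast
    then have "(x, y, y') \<in> Z n m j" using nm by (simp add: Z_def)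
    then have "p \<in> (\<lambda>q. (fst q, fst (snd q))) ` Z n m j" using p(1) by force
    then show "p \<in> \<Union>((\<lambda>(n, m, j). (\<lambda>q. (fst q, fst (snd q))) ` Z n m j) ` UNIV)" by fast
  next
    fix p assume "p \<in> \<Union>((\<lambda>(n, m, j). (\<lambda>q. (fst q, fst (snd q))) ` Z n m j) ` UNIV)"
    then obtain n m j q where q: "q \<in> Z n m j" "p = (fst q, fst (snd q))" by auto
    then have "snd q \<in> {p. fst p \<noteq> snd p}" unfolding C(2) by (auto simp: Z_def)
    then have "snd (snd q) \<noteq> fst (snd q)" by simp
    moreover have "(fst q, fst (snd q)) \<in> T" "(fst q, snd (snd q)) \<in> T"
      using q(1) unfolding K(2) Z_def by auto
    ultimately show "p \<in> x_branching T" unfolding q(2) x_branching_def by blast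
  qed
  also have "sigma_compact \<dots>"
    using cptZ by (intro sigma_compactI_countable) auto
  finally show ?thesis .
qed

lemma y_branching_swap: "y_branching T = prod.swap ` x_branching (prod.swap ` T)"
  by (force simp: x_branching_def y_branching_def)

lemma sigma_compact_y_branching:
  fixes T :: "('a::{second_countable_topology, t2_space} \<times> 'b::{second_countable_topology, t2_space}) set"
  assumes cpt: "compact (UNIV :: 'a set)" "compact (UNIV :: 'b set)" and T: "sigma_compact T"
  shows "sigma_compact (y_branching T)"
  unfolding y_branching_swap
  by (intro sigma_compact_image sigma_compact_x_branching cpt T continuous_on_swap)

lemma sigma_compact_prune_iter:
  fixes T :: "('a::{second_countable_topology, t2_space} \<times> 'b::{second_countable_topology, t2_space}) set"
  assumes cpt: "compact (UNIV :: 'a set)" "compact (UNIV :: 'b set)" and T: "sigma_compact T"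
  shows "sigma_compact ((prune ^^ n) T)"
  by (induction n) (auto simp: prune_def intro!: T sigma_compact_Int sigma_compact_x_branching
    sigma_compact_y_branching cpt)

lemma prune_iter_subset: "(prune ^^ n) T \<subseteq> T"
  by (induction n) (auto simp: prune_def x_branching_def)

section \<open>Edges surviving the pruning lie on long chains\<close>

text \<open>
  Walks along edges that change the right and the left end point in turn, hence never backtrack;
  \<open>b\<close> tells whether the right end point is changed first.
\<close>

definition alternating_walk :: "bool \<Rightarrow> ('a \<times> 'b) list \<Rightarrow> bool" where
  "alternating_walk b p \<longleftrightarrow> (\<forall>l. l + 1 < length p \<longrightarrow>
     (if even l = b then fst (p ! l) = fst (p ! (l + 1)) \<and> snd (p ! l) \<noteq> snd (p ! (l + 1))
      else snd (p ! l) = snd (p ! (l + 1)) \<and> fst (p ! l) \<noteq> fst (p ! (l + 1))))"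

text \<open>
  An edge that survives \<open>n + 1\<close> rounds has, at either end point, a neighbour that survives \<open>n\<close>
  rounds.
\<close>

lemma prune_iter_alternating_walk:
  "z \<in> (prune ^^ n) T \<Longrightarrow> \<exists>p. length p = Suc n \<and> p ! 0 = z \<and> set p \<subseteq> T \<and> alternating_walk b p"
proof (induction n arbitrary: z b)
  case 0
  then show ?case by (intro exI[of _ "[z]"]) (auto simp: alternating_walk_def)
next
  case (Suc n)
  then have z: "z \<in> prune ((prune ^^ n) T)" by simp
  obtain z' where z': "z' \<in> (prune ^^ n) T"
    "if b then fst z = fst z' \<and> snd z \<noteq> snd z' else snd z = snd z' \<and> fst z \<noteq> fst z'"
    using z by (cases b) (auto simp: prune_def x_branching_def y_branching_def)
  obtain p where p: "length p = Suc n" "p ! 0 = z'" "set p \<subseteq> T" "alternating_walk (\<not> b) p"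
    using Suc.IH[OF z'(1), of "\<not> b"] by blast
  have "alternating_walk b (z # p)"
    unfolding alternating_walk_def
  proof (intro allI impI)
    fix l assume l: "l + 1 < length (z # p)"
    show "if even l = b then fst ((z # p) ! l) = fst ((z # p) ! (l + 1)) \<and> snd ((z # p) ! l) \<noteq> snd ((z # p) ! (l + 1))
      else snd ((z # p) ! l) = snd ((z # p) ! (l + 1)) \<and> fst ((z # p) ! l) \<noteq> fst ((z # p) ! (l + 1))"
    proof (cases l)
      case 0
      then show ?thesis using z'(2) p(2) by simp
    next
      case (Suc l')
      have "l' + 1 < length p" using l Suc by simp
      then show ?thesis using p(4) Suc unfolding alternating_walk_def by (auto split: if_splits)
    qed
  qed
  moreover have "set (z # p) \<subseteq> T"
    using p(3) Suc.prems prune_iter_subset[of "Suc n" T] by auto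
  ultimately show ?case using p(1) by (intro exI[of _ "z # p"]) auto
qed

lemma cyclically_monotone_subset:
  "cyclically_monotone c A \<Longrightarrow> B \<subseteq> A \<Longrightarrow> cyclically_monotone c B"
  unfolding cyclically_monotone_def by blast

text \<open>
  In a chain the coordinate that has just changed must stay fixed in the next step, which is what
  alternation means; the capped index \<open>min (L - 1) (l + 2)\<close> makes this void at the last step.
\<close>

lemma alternating_walk_is_chain:
  assumes p: "alternating_walk b p" "set p \<subseteq> T" "p \<noteq> []" and T: "T \<subseteq> S" "cyclically_monotone c T"
    and dx: "\<And>x y y'. (x, y) \<in> T \<Longrightarrow> (x, y') \<in> T \<Longrightarrow> partial_x \<A> c x y = partial_x \<A> c x y'"
    and dy: "\<And>x x' y. (x, y) \<in> T \<Longrightarrow> (x', y) \<in> T \<Longrightarrow> partial_y \<B> c x y = partial_y \<B> c x' y"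
  shows "is_chain \<A> \<B> c S p"
proof -
  have mem: "p ! l \<in> T" if "l < length p" for l using p(2) that by (auto dest: nth_mem)
  have step: "if even l = b then fst (p ! l) = fst (p ! (l + 1)) \<and> snd (p ! l) \<noteq> snd (p ! (l + 1))
      else snd (p ! l) = snd (p ! (l + 1)) \<and> fst (p ! l) \<noteq> fst (p ! (l + 1))" if "l + 1 < length p" for l
    using p(1) that unfolding alternating_walk_def by blast
  have "(fst (p ! l) = fst (p ! (l + 1)) \<and> snd (p ! l) \<noteq> snd (p ! (l + 1)) \<and>
        snd (p ! (l + 1)) = snd (p ! min (length p - 1) (l + 2)) \<and>
        partial_x \<A> c (fst (p ! l)) (snd (p ! l)) = partial_x \<A> c (fst (p ! l)) (snd (p ! (l + 1)))) \<or>
      (snd (p ! l) = snd (p ! (l + 1)) \<and> fst (p ! l) \<noteq> fst (p ! (l + 1)) \<and>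
        fst (p ! (l + 1)) = fst (p ! min (length p - 1) (l + 2)) \<and>
        partial_y \<B> c (fst (p ! l)) (snd (p ! l)) = partial_y \<B> c (fst (p ! (l + 1))) (snd (p ! l)))"
    if l: "l + 1 < length p" for l
  proof -
    have T_l: "p ! l \<in> T" "p ! (l + 1) \<in> T" using mem l by auto
    have last: "min (length p - 1) (l + 2) = (if l + 2 < length p then l + 2 else l + 1)"
      using l by (auto simp: min_def)
    show ?thesis
    proof (cases "even l = b")
      case True
      then have 1: "fst (p ! l) = fst (p ! (l + 1))" "snd (p ! l) \<noteq> snd (p ! (l + 1))"
        using step[OF l] by auto
      have "snd (p ! (l + 1)) = snd (p ! min (length p - 1) (l + 2))"
      proof (cases "l + 2 < length p")
        case True
        then show ?thesis using step[of "l + 1"] \<open>even l = b\<close> unfolding last by auto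
      qed (simp only: last if_False)
      moreover have "partial_x \<A> c (fst (p ! l)) (snd (p ! l)) = partial_x \<A> c (fst (p ! l)) (snd (p ! (l + 1)))"
      proof (rule dx)
        show "(fst (p ! l), snd (p ! l)) \<in> T" using T_l(1) by simp
        show "(fst (p ! l), snd (p ! (l + 1))) \<in> T" unfolding 1(1) using T_l(2) by simp
      qed
      ultimately show ?thesis using 1 by blast
    next
      case False
      then have 1: "snd (p ! l) = snd (p ! (l + 1))" "fst (p ! l) \<noteq> fst (p ! (l + 1))"
        using step[OF l] by auto
      have "fst (p ! (l + 1)) = fst (p ! min (length p - 1) (l + 2))"
      proof (cases "l + 2 < length p")
        case True
        then show ?thesis using step[of "l + 1"] \<open>(even l) \<noteq> b\<close> unfolding last by auto
      qed (simp only: last if_False)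
      moreover have "partial_y \<B> c (fst (p ! l)) (snd (p ! l)) = partial_y \<B> c (fst (p ! (l + 1))) (snd (p ! l))"
      proof (rule dy)
        show "(fst (p ! l), snd (p ! l)) \<in> T" using T_l(1) by simp
        show "(fst (p ! (l + 1)), snd (p ! l)) \<in> T" unfolding 1(1) using T_l(2) by simp
      qed
      ultimately show ?thesis using 1 by blast
    qed
  qed
  moreover have "cyclically_monotone c (set p)" using T(2) p(2) by (rule cyclically_monotone_subset)
  moreover have "1 \<le> length p" using p(3) by (cases p) auto
  ultimately show ?thesis
    using p(2) T(1) unfolding is_chain_def Let_def by blast
qed

section \<open>Couplings agree on pruned edges\<close>

text \<open>
  For closed \<open>C \<subseteq> B\<close> injectivity gives \<open>C = f -` (f ` C) \<inter> R\<close>, whose measure is known from the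
  image measure under \<open>f\<close> and from the part off \<open>R\<close>. Closed sets are used since only their images are known to be
  measurable.
\<close>

lemma finite_measures_agree_on_injective_part:
  fixes M M' :: "'x::{second_countable_topology, t2_space} measure"
    and f :: "'x \<Rightarrow> 'z::t2_space"
  assumes cpt: "compact (UNIV :: 'x set)" and M: "finite_measure M" "sets M = sets borel"
    and M': "finite_measure M'" "sets M' = sets borel"
    and f: "continuous_on UNIV f" "\<And>A. closed A \<Longrightarrow> measure M (f -` A) = measure M' (f -` A)"
    and R: "R \<in> sets borel" and off: "\<And>B. B \<in> sets borel \<Longrightarrow> measure M (B - R) = measure M' (B - R)"
    and B: "B \<in> sets borel" "B \<subseteq> R"
    and inj: "\<And>z z'. z \<in> B \<Longrightarrow> z' \<in> R \<Longrightarrow> f z = f z' \<Longrightarrow> z = z'"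
  shows "measure M B = measure M' B"
proof -
  have eq: "measure M C = measure M' C" if C: "closed C" "C \<subseteq> B" for C
  proof -
    have "compact (f ` C)"
      using closed_imp_compact_of_compact_UNIV[OF cpt C(1)] f(1)
      by (intro compact_continuous_image) (auto intro: continuous_on_subset)
    then have cl: "closed (f ` C)" by (rule compact_imp_closed)
    have cl': "closed (f -` (f ` C))"
      using closed_vimage[OF cl f(1)] .
    define V where "V = f -` (f ` C)"
    have V: "V \<in> sets borel" using cl' by (simp add: V_def)
    \<comment> \<open>\<open>V - (V - R)\<close> is \<open>V \<inter> R\<close>, written so that only \<open>V\<close> and a set off \<open>R\<close> are measured.\<close>
    have "C = V - (V - R)"
    proof (intro set_eqI iffI)
      fix z assume "z \<in> C"
      then have "z \<in> R" "z \<in> V" using C(2) B(2) by (auto simp: V_def)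
      then show "z \<in> V - (V - R)" by simp
    next
      fix z' assume "z' \<in> V - (V - R)"
      then have "z' \<in> R" "f z' \<in> f ` C" by (auto simp: V_def)
      then obtain z where z: "z \<in> C" "f z = f z'" by (metis imageE)
      then have "z = z'" using inj[OF subsetD[OF C(2) z(1)] \<open>z' \<in> R\<close>] by simp
      then show "z' \<in> C" using z(1) by simp
    qed
    moreover have "measure L (V - (V - R)) = measure L V - measure L (V - R)"
      if "finite_measure L" "sets L = sets borel" for L
      using that V R by (intro finite_measure.finite_measure_Diff) auto
    ultimately have "measure M C = measure M V - measure M (V - R)" "measure M' C = measure M' V - measure M' (V - R)"
      using M M' by metis+
    then show ?thesis using f(2)[OF cl] off[OF V] by (simp add: V_def)
  qed
  show ?thesis
    using finite_borel_measure_le_by_closed[OF cpt M M' _ B(1)] finite_borel_measure_le_by_closed[OF cpt M' M _ B(1)] eq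
    by (metis order_antisym order_refl)
qed

text \<open>
  In each round the removed edges are those that are alone at their left end point, on which
  \<^const>\<open>fst\<close> is injective, and those alone at their right end point, on which \<^const>\<open>snd\<close> is.
  Both projections have the same image measure for the two couplings.
\<close>

lemma couplings_agree_off_prune_iter:
  fixes \<mu> :: "'a::{second_countable_topology, t2_space} measure"
    and \<nu> :: "'b::{second_countable_topology, t2_space} measure"
  assumes cpt: "compact (UNIV :: 'a set)" "compact (UNIV :: 'b set)"
    and \<gamma>: "\<gamma> \<in> couplings \<mu> \<nu>" "\<gamma>' \<in> couplings \<mu> \<nu>" and \<mu>: "prob_space \<mu>"
    and T: "sigma_compact T" "- T \<in> null_sets \<gamma>" "- T \<in> null_sets \<gamma>'"
    and B: "B \<in> sets borel"
  shows "measure \<gamma> (B - (prune ^^ n) T) = measure \<gamma>' (B - (prune ^^ n) T)"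
  using B
proof (induction n arbitrary: B)
  case 0
  have "measure L (B - T) = 0" if "- T \<in> null_sets L" "sets L = sets borel" for L
  proof -
    have "B - T \<in> null_sets L"
      by (rule null_sets_subset[OF that(1)]) (use 0 sigma_compact_borel[OF T(1)] that(2) in auto)
    then show ?thesis by (simp add: measure_eq_0_null_sets)
  qed
  then show ?case using T(2,3) \<gamma> by (simp add: couplings_def)
next
  case (Suc n)
  have cpt_prod: "compact (UNIV :: ('a \<times> 'b) set)"
    using compact_Times[OF cpt] by simp
  define R where "R = (prune ^^ n) T"
  have R: "sigma_compact R" unfolding R_def by (rule sigma_compact_prune_iter[OF cpt T(1)])
  have off: "measure \<gamma> (B - R) = measure \<gamma>' (B - R)" if "B \<in> sets borel" for B
    using Suc.IH[OF that] by (simp add: R_def)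
  have fin: "finite_measure \<gamma>" "finite_measure \<gamma>'"
    using coupling_prob_space[OF _ \<mu>] \<gamma> prob_space.axioms(1) by blast+
  have sets: "sets \<gamma> = sets borel" "sets \<gamma>' = sets borel" using \<gamma> by (auto simp: couplings_def)
  have proj: "measure \<gamma> (fst -` A) = measure \<gamma>' (fst -` A)" if "closed A" for A
  proof -
    have "measure L (fst -` A) = measure \<mu> A" if "L \<in> couplings \<mu> \<nu>" for L
    proof -
      have L: "sets L = sets borel" "distr L borel fst = \<mu>" using that by (auto simp: couplings_def)
      have "measure (distr L borel fst) A = measure L (fst -` A \<inter> space L)"
        using \<open>closed A\<close> measurable_if_sets_borel[OF L(1) measurable_borel_fst_snd(1)] by (intro measure_distr) auto
      then show ?thesis using L sets_eq_imp_space_eq[OF L(1)] by simp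
    qed
    then show ?thesis using \<gamma> by simp
  qed
  have proj': "measure \<gamma> (snd -` A) = measure \<gamma>' (snd -` A)" if "closed A" for A
  proof -
    have "measure L (snd -` A) = measure \<nu> A" if "L \<in> couplings \<mu> \<nu>" for L
    proof -
      have L: "sets L = sets borel" "distr L borel snd = \<nu>" using that by (auto simp: couplings_def)
      have "measure (distr L borel snd) A = measure L (snd -` A \<inter> space L)"
        using \<open>closed A\<close> measurable_if_sets_borel[OF L(1) measurable_borel_fst_snd(2)] by (intro measure_distr) auto
      then show ?thesis using L sets_eq_imp_space_eq[OF L(1)] by simp
    qed
    then show ?thesis using \<gamma> by simp
  qed
  note borel = sigma_compact_borel[OF R] sigma_compact_borel[OF sigma_compact_x_branching[OF cpt R]]
    sigma_compact_borel[OF sigma_compact_y_branching[OF cpt R]]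
  have x_leaves: "measure \<gamma> (B \<inter> (R - x_branching R)) = measure \<gamma>' (B \<inter> (R - x_branching R))"
    if "B \<in> sets borel" for B
  proof (rule finite_measures_agree_on_injective_part[OF cpt_prod fin(1) sets(1) fin(2) sets(2)
        continuous_on_fst[OF continuous_on_id] proj borel(1) off])
    show "B \<inter> (R - x_branching R) \<in> sets borel" using that borel by auto
    show "z = z'" if "z \<in> B \<inter> (R - x_branching R)" "z' \<in> R" "fst z = fst z'" for z z'
      using that unfolding x_branching_def by (cases z; cases z') (simp, metis)
  qed auto
  have y_leaves: "measure \<gamma> (B \<inter> (R - y_branching R)) = measure \<gamma>' (B \<inter> (R - y_branching R))"
    if "B \<in> sets borel" for B
  proof (rule finite_measures_agree_on_injective_part[OF cpt_prod fin(1) sets(1) fin(2) sets(2)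
        continuous_on_snd[OF continuous_on_id] proj' borel(1) off])
    show "B \<inter> (R - y_branching R) \<in> sets borel" using that borel by auto
    show "z = z'" if "z \<in> B \<inter> (R - y_branching R)" "z' \<in> R" "snd z = snd z'" for z z'
      using that unfolding y_branching_def by (cases z; cases z') (simp, metis)
  qed auto
  define B1 where "B1 = B \<inter> (R - x_branching R)"
  define B2 where "B2 = (B - (R - x_branching R)) \<inter> (R - y_branching R)"
  have meas: "B - R \<in> sets borel" "B1 \<in> sets borel" "B2 \<in> sets borel"
    using Suc.prems borel by (auto simp: B1_def B2_def)
  have split: "B - prune R = (B - R) \<union> (B1 \<union> B2)"
    by (auto simp: B1_def B2_def prune_def x_branching_def)
  have disj: "(B - R) \<inter> (B1 \<union> B2) = {}" "B1 \<inter> B2 = {}" by (auto simp: B1_def B2_def)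
  have decomp: "measure L (B - prune R) = measure L (B - R) + (measure L B1 + measure L B2)"
    if L: "finite_measure L" "sets L = sets borel" for L
  proof -
    have "measure L (B - prune R) = measure L (B - R) + measure L (B1 \<union> B2)"
      unfolding split using disj meas L(2) by (intro finite_measure.finite_measure_Union[OF L(1)]) auto
    also have "measure L (B1 \<union> B2) = measure L B1 + measure L B2"
      using disj meas L(2) by (intro finite_measure.finite_measure_Union[OF L(1)]) auto
    finally show ?thesis .
  qed
  have "measure \<gamma> B1 = measure \<gamma>' B1" unfolding B1_def by (rule x_leaves[OF Suc.prems])
  moreover have "measure \<gamma> B2 = measure \<gamma>' B2"
    unfolding B2_def using Suc.prems borel by (intro y_leaves) auto
  ultimately show ?case
    using decomp[OF fin(1) sets(1)] decomp[OF fin(2) sets(2)] off[OF Suc.prems] by (simp add: R_def)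
qed

text \<open>
  Every edge outside the core \<open>\<Inter>n. (prune ^^ n) T\<close> is removed after finitely many rounds, and measures are
  continuous along the increasing sets of removed edges.
\<close>

lemma couplings_eq_if_core_null:
  fixes \<mu> :: "'a::{second_countable_topology, t2_space} measure"
    and \<nu> :: "'b::{second_countable_topology, t2_space} measure"
  assumes cpt: "compact (UNIV :: 'a set)" "compact (UNIV :: 'b set)"
    and \<gamma>: "\<gamma> \<in> couplings \<mu> \<nu>" "\<gamma>' \<in> couplings \<mu> \<nu>" and \<mu>: "prob_space \<mu>"
    and T: "sigma_compact T" "- T \<in> null_sets \<gamma>" "- T \<in> null_sets \<gamma>'"
    and core: "negligible_for \<gamma> (\<Inter>n. (prune ^^ n) T)" "negligible_for \<gamma>' (\<Inter>n. (prune ^^ n) T)"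
  shows "\<gamma> = \<gamma>'"
proof (rule measure_eqI)
  have fin: "finite_measure \<gamma>" "finite_measure \<gamma>'"
    using coupling_prob_space[OF _ \<mu>] \<gamma> prob_space.axioms(1) by blast+
  have sets: "sets \<gamma> = sets borel" "sets \<gamma>' = sets borel" using \<gamma> by (auto simp: couplings_def)
  then show "sets \<gamma> = sets \<gamma>'" by simp
  have iter: "(prune ^^ n) T \<in> sets borel" for n
    by (rule sigma_compact_borel[OF sigma_compact_prune_iter[OF cpt T(1)]])
  fix B assume "B \<in> sets \<gamma>"
  then have B: "B \<in> sets borel" using sets by simp
  have lim: "(\<lambda>n. measure L (B - (prune ^^ n) T)) \<longlonglongrightarrow> measure L B"
    if L: "finite_measure L" "sets L = sets borel" and core: "negligible_for L (\<Inter>n. (prune ^^ n) T)" for L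
  proof -
    have "incseq (\<lambda>n. B - (prune ^^ n) T)"
      by (rule incseq_SucI) (auto simp: prune_def x_branching_def)
    then have "(\<lambda>n. measure L (B - (prune ^^ n) T)) \<longlonglongrightarrow> measure L (\<Union>n. B - (prune ^^ n) T)"
      using B iter L(2) by (intro finite_measure.finite_Lim_measure_incseq[OF L(1)]) auto
    also have "(\<Union>n. B - (prune ^^ n) T) = B - (\<Inter>n. (prune ^^ n) T)" by auto
    also have "measure L (B - (\<Inter>n. (prune ^^ n) T)) = measure L B"
    proof -
      have "(\<Inter>n. (prune ^^ n) T) \<in> sets L" using iter L(2) by auto
      moreover obtain N where "N \<in> null_sets L" "(\<Inter>n. (prune ^^ n) T) \<subseteq> N"
        using core unfolding negligible_for_def null_sets_completion_iff2 by blast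
      ultimately have "(\<Inter>n. (prune ^^ n) T) \<in> null_sets L" using null_sets_subset by blast
      then show ?thesis using B L(2) by (intro measure_Diff_null_set) auto
    qed
    finally show ?thesis .
  qed
  have "measure \<gamma> B = measure \<gamma>' B"
    using LIMSEQ_unique[OF lim[OF fin(1) sets(1) core(1)]] lim[OF fin(2) sets(2) core(2)]
    by (simp add: couplings_agree_off_prune_iter[OF cpt \<gamma> \<mu> T B])
  then show "emeasure \<gamma> B = emeasure \<gamma>' B"
    using fin by (simp add: finite_measure.emeasure_eq_measure)
qed

text \<open>
  Inner regularity by closed sets, applied to the complement of a Borel null set that contains
  the complement of \<open>A\<close>; the set \<open>A\<close> itself may fail to be Borel.
\<close>

lemma sigma_compact_of_full_measure:
  fixes M :: "'x::{second_countable_topology, t2_space} measure"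
  assumes cpt: "compact (UNIV :: 'x set)" and M: "finite_measure M" "sets M = sets borel"
    and A: "negligible_for M (- A)"
  obtains T where "sigma_compact T" "T \<subseteq> A" "- T \<in> null_sets M"
proof -
  interpret finite_measure M by fact
  obtain N where N: "N \<in> null_sets M" "- A \<subseteq> N"
    using A unfolding negligible_for_def null_sets_completion_iff2 by blast
  have N_borel: "- N \<in> sets borel" using null_setsD2[OF N(1)] M(2) by (simp add: borel_comp)
  have "\<exists>C. closed C \<and> C \<subseteq> - N \<and> measure M (- N - C) < 1 / Suc n" for n
  proof -
    obtain C U where CU: "closed C" "open U" "C \<subseteq> - N" "- N \<subseteq> U" "measure M (U - C) < 1 / Suc n"
      by (rule finite_borel_measure_regular[OF cpt M N_borel, of "1 / Suc n"]) (auto intro: that)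
    have "measure M (- N - C) \<le> measure M (U - C)"
      using CU M(2) by (intro finite_measure_mono) auto
    then show ?thesis using CU by force
  qed
  then obtain C where C: "\<And>n. closed (C n)" "\<And>n. C n \<subseteq> - N" "\<And>n. measure M (- N - C n) < 1 / Suc n"
    by metis
  define T where "T = (\<Union>n. C n)"
  have T_sets: "T \<in> sets borel" unfolding T_def using C(1) by auto
  have "measure M (- N - T) \<le> 1 / Suc n" for n
  proof -
    have "measure M (- N - T) \<le> measure M (- N - C n)"
      using C(1) N_borel M(2) by (intro finite_measure_mono) (auto simp: T_def)
    then show ?thesis using C(3)[of n] by simp
  qed
  then have "measure M (- N - T) \<le> 0"
    by (intro LIMSEQ_le_const[OF LIMSEQ_Suc[OF lim_1_over_n]]) auto
  then have "measure M (- N - T) = 0" by (simp add: measure_le_0_iff)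
  moreover have "- N - T \<in> sets M" using N_borel T_sets M(2) by (simp add: sets.Diff)
  ultimately have "- N - T \<in> null_sets M" by (intro null_setsI) (simp_all add: emeasure_eq_measure)
  then have "N \<union> (- N - T) \<in> null_sets M" using N(1) by (intro null_sets.Un)
  moreover have "- T \<in> sets M" using T_sets M(2) by (simp add: borel_comp)
  ultimately have "- T \<in> null_sets M" by (rule null_sets_subset) auto
  show thesis
  proof
    show "sigma_compact T"
      unfolding sigma_compact_def T_def
      using closed_imp_compact_of_compact_UNIV[OF cpt C(1)] by blast
    show "T \<subseteq> A" using C(2) N(2) by (auto simp: T_def)
    show "- T \<in> null_sets M" by fact
  qed
qed

lemma negligible_for_vimage:
  assumes "sets \<gamma> = sets borel" "f \<in> measurable borel borel" "distr \<gamma> borel f = \<mu>" "negligible_for \<mu> A"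
  shows "negligible_for \<gamma> (f -` A)"
proof -
  have f: "f \<in> measurable \<gamma> borel" using assms(1,2) by (rule measurable_if_sets_borel)
  obtain N where N: "N \<in> null_sets \<mu>" "A \<subseteq> N"
    using assms(4) unfolding negligible_for_def null_sets_completion_iff2 by blast
  have "f -` N \<inter> space \<gamma> \<in> null_sets \<gamma>"
    using N(1) f unfolding assms(3)[symmetric] by (simp add: null_sets_distr_iff)
  moreover have "f -` A \<subseteq> f -` N \<inter> space \<gamma>"
    using N(2) sets_eq_imp_space_eq[OF assms(1)] by auto
  ultimately show ?thesis unfolding negligible_for_def null_sets_completion_iff2 by blast
qed

lemma negligible_for_subset: "negligible_for M A \<Longrightarrow> B \<subseteq> A \<Longrightarrow> negligible_for M B"
  unfolding negligible_for_def null_sets_completion_iff2 by blast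

lemma negligible_for_Un: "negligible_for M A \<Longrightarrow> negligible_for M B \<Longrightarrow> negligible_for M (A \<union> B)"
  unfolding negligible_for_def by (rule null_sets.Un)

section \<open>Uniqueness of the optimal coupling\<close>

theorem corollary1p6:
  fixes \<A> :: "('a::{second_countable_topology, t2_space}, 'e::euclidean_space) chart set"
    and \<B> :: "('b::{second_countable_topology, t2_space}, 'f::euclidean_space) chart set"
    and c :: "'a \<times> 'b \<Rightarrow> real"
    and \<mu> :: "'a measure" and \<nu> :: "'b measure"
    and E\<^sub>0 :: "('a \<times> 'b) set"
  assumes "closed_manifold \<A>" and "closed_manifold \<B>"
    and "Ck_function 1 (prod_atlas \<A> \<B>) c"
    and "sets \<mu> = sets borel" and "prob_space \<mu>" and "abs_continuous_in_charts \<A> \<mu>"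
    and "sets \<nu> = sets borel" and "prob_space \<nu>" and "abs_continuous_in_charts \<B> \<nu>"
    and "sigma_compact E\<^sub>0"
    and "\<forall>\<gamma>\<in>optimal_couplings c \<mu> \<nu>. negligible_for \<gamma> E\<^sub>0"
    and "negligible_for \<mu> (fst ` E_infinity \<A> \<B> c (UNIV - E\<^sub>0)) \<or>
         negligible_for \<nu> (snd ` E_infinity \<A> \<B> c (UNIV - E\<^sub>0))"
  shows "(\<forall>\<gamma>\<in>optimal_couplings c \<mu> \<nu>. negligible_for \<gamma> (E_infinity \<A> \<B> c (UNIV - E\<^sub>0))) \<and>
         is_singleton (optimal_couplings c \<mu> \<nu>)"
proof -
  let ?E = "E_infinity \<A> \<B> c (UNIV - E\<^sub>0)"
  let ?Opt = "optimal_couplings c \<mu> \<nu>"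
  note \<mu> = assms(5,4) and \<nu> = assms(8,7)
  have \<A>: "smooth_atlas \<A>" and cptA: "compact (UNIV :: 'a set)"
    and \<B>: "smooth_atlas \<B>" and cptB: "compact (UNIV :: 'b set)"
    using assms(1,2) by (auto simp: closed_manifold_def)
  have cpt_prod: "compact (UNIV :: ('a \<times> 'b) set)"
    using compact_Times[OF cptA cptB] by simp
  have c_cont: "continuous_on UNIV c" by (rule Ck_function_1_imp_continuous[OF \<A> \<B> assms(3)])
  note c_C1 = Ck_function_1_imp_C1_in_variables[OF \<A> \<B> assms(3)]
  have coup: "\<gamma> \<in> couplings \<mu> \<nu>" if "\<gamma> \<in> ?Opt" for \<gamma>
    using that by (simp add: optimal_couplings_def is_arg_min_def)
  have fin: "finite_measure \<gamma>" and sets: "sets \<gamma> = sets borel"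
    and marg: "distr \<gamma> borel fst = \<mu>" "distr \<gamma> borel snd = \<nu>" if "\<gamma> \<in> ?Opt" for \<gamma>
    using coupling_prob_space[OF coup[OF that] \<mu>(1)] coup[OF that]
    by (auto simp: couplings_def prob_space_def)
  have vimage_fst: "negligible_for \<gamma> (fst -` A)" if "\<gamma> \<in> ?Opt" "negligible_for \<mu> A" for \<gamma> A
    using that by (intro negligible_for_vimage[OF sets measurable_borel_fst_snd(1) marg(1)])
  have vimage_snd: "negligible_for \<gamma> (snd -` A)" if "\<gamma> \<in> ?Opt" "negligible_for \<nu> A" for \<gamma> A
    using that by (intro negligible_for_vimage[OF sets measurable_borel_fst_snd(2) marg(2)])
  have E_neg: "negligible_for \<gamma> ?E" if "\<gamma> \<in> ?Opt" for \<gamma>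
    using assms(12)
  proof
    assume "negligible_for \<mu> (fst ` ?E)"
    from vimage_fst[OF that this] show ?thesis by (rule negligible_for_subset) auto
  next
    assume "negligible_for \<nu> (snd ` ?E)"
    from vimage_snd[OF that this] show ?thesis by (rule negligible_for_subset) auto
  qed
  have unique: "\<gamma> = \<gamma>'" if \<gamma>: "\<gamma> \<in> ?Opt" and \<gamma>': "\<gamma>' \<in> ?Opt" for \<gamma> \<gamma>'
  proof -
    define S where "S = measure_support \<gamma> \<union> measure_support \<gamma>'"
    have S_closed: "closed S" unfolding S_def by (intro closed_Un closed_measure_support)
    have S_cm: "cyclically_monotone c S"
      by (rule cyclically_monotone_subset[OF
        union_supports_cyclically_monotone[OF cptA cptB c_cont \<mu> \<nu>]]) (use \<gamma> \<gamma>' in \<open>auto simp: S_def\<close>)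
    have two: "c (x, y) + c (x', y') \<le> c (x', y) + c (x, y')" if "(x, y) \<in> S" "(x', y') \<in> S" for x y x' y'
    proof -
      have "0 \<le> (\<Sum>i<2. c ((if Suc i mod 2 = 0 then x else x'), (if i = 0 then y else y')) -
          c ((if i = 0 then x else x'), (if i = 0 then y else y')))"
        using S_cm[unfolded cyclically_monotone_def, rule_format, of 2
          "\<lambda>i. if i = 0 then x else x'" "\<lambda>i. if i = 0 then y else y'"] that by auto
      then show ?thesis by (simp add: numeral_2_eq_2)
    qed
    define DM where "DM = {x. \<exists>y z. (x, y) \<in> S \<and> (x, z) \<in> S \<and> partial_x \<A> c x y \<noteq> partial_x \<A> c x z}"
    define DN where "DN = {y. \<exists>x z. (x, y) \<in> S \<and> (z, y) \<in> S \<and> partial_y \<B> c x y \<noteq> partial_y \<B> c z y}"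
    have DM: "negligible_for \<mu> DM"
      unfolding DM_def by (rule partial_x_nonunique_negligible[OF \<A> cptB c_C1(1) \<mu>(2) assms(6) S_closed two])
    have DN: "negligible_for \<nu> DN"
    proof -
      have "closed (prod.swap -` S)"
        using S_closed by (intro closed_vimage) (auto intro: continuous_on_swap)
      from partial_x_nonunique_negligible[OF \<B> cptA c_C1(2) \<nu>(2) assms(9) this]
      have "negligible_for \<nu> {y. \<exists>x z. (y, x) \<in> prod.swap -` S \<and> (y, z) \<in> prod.swap -` S \<and>
          partial_x \<B> (\<lambda>(y, x). c (x, y)) y x \<noteq> partial_x \<B> (\<lambda>(y, x). c (x, y)) y z}"
        using two by (force simp: add.commute)
      then show ?thesis by (simp add: DN_def partial_x_def partial_y_def)
    qed
    define A where "A = S - (fst -` DM \<union> snd -` DN \<union> E\<^sub>0)"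
    have A_full: "negligible_for \<kappa> (- A)" if \<kappa>: "\<kappa> \<in> {\<gamma>, \<gamma>'}" for \<kappa>
    proof -
      have opt: "\<kappa> \<in> ?Opt" using \<kappa> \<gamma> \<gamma>' by auto
      have "negligible_for \<kappa> (- measure_support \<kappa>)"
        unfolding negligible_for_def
        by (intro null_sets_completionI null_sets_Compl_measure_support fin sets opt)
      then have "negligible_for \<kappa> (- measure_support \<kappa> \<union> fst -` DM \<union> snd -` DN \<union> E\<^sub>0)"
        using vimage_fst[OF opt DM] vimage_snd[OF opt DN] assms(11) opt by (intro negligible_for_Un) auto
      then show ?thesis by (rule negligible_for_subset) (use \<kappa> in \<open>auto simp: A_def S_def\<close>)
    qed
    obtain T1 where T1: "sigma_compact T1" "T1 \<subseteq> A" "- T1 \<in> null_sets \<gamma>"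
      by (rule sigma_compact_of_full_measure[OF cpt_prod fin[OF \<gamma>] sets[OF \<gamma>] A_full]) (simp, rule that)
    obtain T2 where T2: "sigma_compact T2" "T2 \<subseteq> A" "- T2 \<in> null_sets \<gamma>'"
      by (rule sigma_compact_of_full_measure[OF cpt_prod fin[OF \<gamma>'] sets[OF \<gamma>'] A_full]) (simp, rule that)
    define T where "T = T1 \<union> T2"
    have T_sc: "sigma_compact T" unfolding T_def by (intro sigma_compact_Un T1 T2)
    have T_null: "- T \<in> null_sets \<gamma>" "- T \<in> null_sets \<gamma>'"
    proof -
      have "- T \<in> sets \<gamma>" "- T \<in> sets \<gamma>'"
        using sigma_compact_borel[OF T_sc] sets[OF \<gamma>] sets[OF \<gamma>'] by (simp_all add: borel_comp)
      then show "- T \<in> null_sets \<gamma>" "- T \<in> null_sets \<gamma>'"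
        using T1(3) T2(3) by (auto simp: T_def elim: null_sets_subset)
    qed
    have TA: "T \<subseteq> A" using T1 T2 by (auto simp: T_def)
    have core: "(\<Inter>n. (prune ^^ n) T) \<subseteq> ?E"
    proof
      fix z assume z: "z \<in> (\<Inter>n. (prune ^^ n) T)"
      have "\<exists>k\<ge>n. \<exists>p. is_chain \<A> \<B> c (UNIV - E\<^sub>0) p \<and> length p = k \<and> z \<in> set p" for n
      proof -
        obtain p where p: "length p = Suc n" "p ! 0 = z" "set p \<subseteq> T" "alternating_walk True p"
          using prune_iter_alternating_walk[of z n T True] z by blast
        have "is_chain \<A> \<B> c (UNIV - E\<^sub>0) p"
        proof (rule alternating_walk_is_chain[OF p(4,3)])
          show "p \<noteq> []" using p(1) by auto
          show "T \<subseteq> UNIV - E\<^sub>0" using TA by (auto simp: A_def)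
          show "cyclically_monotone c T"
            by (rule cyclically_monotone_subset[OF S_cm]) (use TA in \<open>auto simp: A_def\<close>)
          show "partial_x \<A> c x y = partial_x \<A> c x y'" if "(x, y) \<in> T" "(x, y') \<in> T" for x y y'
          proof -
            have "(x, y) \<in> S" "(x, y') \<in> S" "x \<notin> DM" using that TA by (auto simp: A_def)
            then show ?thesis unfolding DM_def by blast
          qed
          show "partial_y \<B> c x y = partial_y \<B> c x' y" if "(x, y) \<in> T" "(x', y) \<in> T" for x x' y
          proof -
            have "(x, y) \<in> S" "(x', y) \<in> S" "y \<notin> DN" using that TA by (auto simp: A_def)
            then show ?thesis unfolding DN_def by blast
          qed
        qed
        moreover have "z \<in> set p" using p(1,2) by (metis nth_mem zero_less_Suc)
        ultimately show ?thesis using p(1) by (intro exI[of _ "Suc n"]) auto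
      qed
      then show "z \<in> ?E" by (simp add: E_infinity_def)
    qed
    show ?thesis
      by (rule couplings_eq_if_core_null[OF cptA cptB coup[OF \<gamma>] coup[OF \<gamma>'] \<mu>(1) T_sc T_null])
        (rule negligible_for_subset[OF E_neg core], fact)+
  qed
  show ?thesis
  proof
    show "\<forall>\<gamma>\<in>?Opt. negligible_for \<gamma> ?E" using E_neg by blast
    show "is_singleton ?Opt"
      using optimal_coupling_exists[OF cptA cptB c_cont \<mu> \<nu>] unique by (rule is_singletonI')
  qed
qed

end
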